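(* For $v\in S^1\subset\mathbb{R}^2$ let $v^\perp$ denote the point of $S^1$ obtained by rotating $v$ anticlockwise by a quarter turn. For every $M>0$, the set of all $g\in\mathbb{S}_2$ such that \[\int_{\mathbb{R}^2}\int_{S^1}\int_0^\infty e^{-s}g(x)g(x+y)g(x+2\alpha y^\perp+sy)\,ds\,d\sigma(y)\,dx\neq 0\quad\text{for every }\alpha\in(0,M]\] contains an open neighbourhood (in $\mathbb{S}_2$) of $\delta\mathbf{1}$ for every $\delta\in(0,1]$. In particular, for every $M>0$ the property $P_M$, defined by $P_M(A)=1$ if and only if for each $\alpha\in(0,M]$ there exist points $x,y,z\in A$ forming the vertices of a triangle of area $\alpha$ in which at least one side has length exactly $1$, is a mild property.
   Context: $\mathbb{S}_2$ denotes the set of all $f\in L^\infty(\mathbb{R}^2)$ with $0\le f\le1$ almost everywhere, with the weak-* topology inherited from $L^\infty(\mathbb{R}^2)\simeq L^1(\mathbb{R}^2)^*$; $\mathbf{1}$ is the constant function $1$. $\sigma$ is normalised arc-length measure on $S^1$. A property is a function $P$ from the set $\mathfrak{M}(\mathbb{R}^2)$ of Lebesgue measurable subsets of $\mathbb{R}^2$ to $\{0,1\}$. For $\delta\in(0,1]$, $P$ is $\delta$-mild if: (1) there is an open set $\mathbb{U}\subseteq\mathbb{S}_2$ such that $\chi_A\in\mathbb{U}$ implies $P(A)=1$; (2) $\delta\mathbf{1}\in\mathbb{U}$; (3) $P(A)=P(A+v)$ for all $A$ and all $v\in\mathbb{R}^2$. $P$ is mild if it is $\delta$-mild for every $\delta\in(0,1]$.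 *)

theory Defs
  imports "HOL-Analysis.Analysis"
begin

type_synonym pt = "real ^ 2"

definition perp :: "pt \<Rightarrow> pt" where
  "perp v = vector [- (v $ 2), v $ 1]"

definition circ_measure :: "pt measure" where
  "circ_measure = distr (uniform_measure lborel {0..2*pi}) borel (\<lambda>t. vector [cos t, sin t])"

text \<open>S_2: (Borel representatives of) elements f of L^infinity(R^2) with 0 \<le> f \<le> 1 a.e.\<close>
definition S2 :: "(pt \<Rightarrow> real) set" where
  "S2 = {f. f \<in> borel_measurable lborel \<and> (AE x in lborel. 0 \<le> f x \<and> f x \<le> 1)}"

text \<open>Open sets of S_2 in the (subspace) weak-* topology of L^infinity = (L^1)^*.\<close>
definition S2_open :: "(pt \<Rightarrow> real) set \<Rightarrow> bool" where
  "S2_open U \<longleftrightarrow> U \<subseteq> S2 \<and>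
     (\<forall>f\<in>U. \<exists>H::(pt \<Rightarrow> real) set. \<exists>\<epsilon>>0. finite H \<and> (\<forall>h\<in>H. integrable lborel h) \<and>
        {g\<in>S2. \<forall>h\<in>H. \<bar>(\<integral>x. g x * h x \<partial>lborel) - (\<integral>x. f x * h x \<partial>lborel)\<bar> < \<epsilon>} \<subseteq> U)"

text \<open>A property is a map from Lebesgue measurable sets to {0,1}, rendered as a predicate;
  only its values on Lebesgue measurable sets matter.  "chi_A \<in> U" is read in L^infinity,
  i.e. some representative of the class of chi_A lies in U.\<close>
definition delta_mild :: "real \<Rightarrow> (pt set \<Rightarrow> bool) \<Rightarrow> bool" where
  "delta_mild \<delta> P \<longleftrightarrow>
     (\<exists>U. S2_open U \<and>
        (\<forall>A\<in>sets lebesgue. (\<exists>f\<in>U. AE x in lebesgue. f x = indicator A x) \<longrightarrow> P A) \<and>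
        (\<lambda>_. \<delta>) \<in> U) \<and>
     (\<forall>A\<in>sets lebesgue. \<forall>v. P A = P ((\<lambda>x. x + v) ` A))"

definition mild :: "(pt set \<Rightarrow> bool) \<Rightarrow> bool" where
  "mild P \<longleftrightarrow> (\<forall>\<delta>\<in>{0<..1}. delta_mild \<delta> P)"

definition tri_area :: "pt \<Rightarrow> pt \<Rightarrow> pt \<Rightarrow> real" where
  "tri_area x y z = \<bar>(y$1 - x$1) * (z$2 - x$2) - (y$2 - x$2) * (z$1 - x$1)\<bar> / 2"

definition P_M :: "real \<Rightarrow> pt set \<Rightarrow> bool" where
  "P_M M A \<longleftrightarrow> (\<forall>\<alpha>\<in>{0<..M}. \<exists>x\<in>A. \<exists>y\<in>A. \<exists>z\<in>A.
      tri_area x y z = \<alpha> \<and> (dist x y = 1 \<or> dist y z = 1 \<or> dist x z = 1))"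

definition Tint :: "real \<Rightarrow> (pt \<Rightarrow> real) \<Rightarrow> ennreal" where
  "Tint \<alpha> g = (\<integral>\<^sup>+ x. (\<integral>\<^sup>+ y. (\<integral>\<^sup>+ s\<in>{0..}.
      ennreal (exp (- s) * g x * g (x + y) * g (x + (2 * \<alpha>) *\<^sub>R perp y + s *\<^sub>R y)) \<partial>lborel)
      \<partial>circ_measure) \<partial>lborel)"

end

theory Submission
  imports Defs "HOL-Probability.Probability_Measure"
begin

text \<open>
  Write g = \<delta> + h with h weak-* small, and restrict x to the unit ball and s to [0,1].  As
  0 \<le> g \<le> 1, bounding \<bar>e\<bar> by (\<eta> + e^2/\<eta>)/2 shows that the integral is positive once the mean squares
  of h * \<sigma> and of the averages of h over the segments x + 2\<alpha> y_perp + [0,1] y are small.  Translating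
  x by 2\<alpha> y_perp makes the second one independent of \<alpha>, at the price of a ball of radius 1 + 2M; this
  gives the uniformity in \<alpha>.  Expanding the squares, both are integrals of h(u) h(v) against finite
  measures on pairs (u,v) that are absolutely continuous, because differences of two independent
  points of the circle, and of two points of a segment in a random direction, have absolutely
  continuous laws.  Such a form tends to 0 as h does: its density is an L^1 limit of combinations
  of indicators of rectangles, for which the form factors.
\<close>

section \<open>Bilinear forms with absolutely continuous kernels\<close>

text \<open>Products do not pass to weak-* limits in general, so smallness of h says nothing
  directly about a trilinear expression. The circle and the segments supply the missing regularity:
  averaging over them turns weak-* smallness into smallness of local mean squares. Only g(x) stays
  unaveraged, and after the other two factors are replaced by \<delta> it enters linearly. The
  direction y in the third factor is shared with g(x + y), so it cannot be averaged out before
  squaring; the inner variable s has to do the smoothing, which is why that square sits inside the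
  integral over y. Since (0,M] is infinite, neighbourhoods found for single values of \<alpha> could
  not be intersected; one finite set of test functions must serve all \<alpha>, including those near
  0. Perturbations h are bounded by 1 everywhere and not just almost everywhere, because circles and
  segments are Lebesgue null in the plane. Elements of \<open>S2\<close> are repaired on a null set
  to fit this. The neighbourhoods of 0 form a filter, so that limits can be added, multiplied and
  compared.\<close>

definition weak_star_null :: "('a::euclidean_space \<Rightarrow> real) filter" where
  "weak_star_null =
     inf (INF f\<in>{f. integrable lborel f}. filtercomap (\<lambda>h. \<integral>x. h x * f x \<partial>lborel) (nhds 0))
         (principal {h. h \<in> borel_measurable borel \<and> (\<forall>x. \<bar>h x\<bar> \<le> 1)})"

lemma tendsto_weak_star_null:
  assumes "integrable lborel f"
  shows "((\<lambda>h. \<integral>x. h x * f x \<partial>lborel) \<longlongrightarrow> 0) weak_star_null"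
proof -
  have "weak_star_null \<le> filtercomap (\<lambda>h. \<integral>x. h x * f x \<partial>lborel) (nhds 0)"
    unfolding weak_star_null_def using assms by (intro le_infI1 INF_lower) auto
  then show ?thesis
    by (rule filterlim_mono[OF filterlim_filtercomap order_refl])
qed

lemma eventually_weak_star_null_bounded:
  "eventually (\<lambda>h. h \<in> borel_measurable borel \<and> (\<forall>x. \<bar>h x\<bar> \<le> 1)) weak_star_null"
  unfolding weak_star_null_def eventually_inf_principal by simp

text \<open>Brings a filter statement into the shape used by \<open>S2_open\<close>: finitely many
  integrable test functions and one common tolerance.\<close>

lemma eventually_weak_star_nullE:
  assumes "eventually P weak_star_null"
  obtains H e where "finite H" "\<And>f. f \<in> H \<Longrightarrow> integrable lborel f" "e > 0"
    "\<And>h. h \<in> borel_measurable borel \<Longrightarrow> (\<And>x. \<bar>h x\<bar> \<le> 1) \<Longrightarrow>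
       (\<And>f. f \<in> H \<Longrightarrow> \<bar>\<integral>x. h x * f x \<partial>lborel\<bar> < e) \<Longrightarrow> P h"
proof -
  let ?b = "\<lambda>h::'a \<Rightarrow> real. h \<in> borel_measurable borel \<and> (\<forall>x. \<bar>h x\<bar> \<le> 1)"
  let ?I = "\<lambda>f h. \<integral>x. h x * f x \<partial>(lborel::'a measure)"
  obtain H where H: "finite H" "H \<subseteq> {f. integrable lborel f}"
    "eventually (\<lambda>h. ?b h \<longrightarrow> P h) (INF f\<in>H. filtercomap (?I f) (nhds 0))"
    using assms unfolding weak_star_null_def eventually_inf_principal eventually_INF[of _ _ "{f. integrable lborel f}"]
    by auto
  obtain Q where Q: "\<And>f. f \<in> H \<Longrightarrow> eventually (Q f) (filtercomap (?I f) (nhds 0))"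
    "\<And>h. (\<And>f. f \<in> H \<Longrightarrow> Q f h) \<Longrightarrow> ?b h \<longrightarrow> P h"
    using H(3) unfolding eventually_INF_finite[OF H(1)] by blast
  have "\<exists>e>0. \<forall>h. \<bar>?I f h\<bar> < e \<longrightarrow> Q f h" if f: "f \<in> H" for f
  proof -
    obtain R where "eventually R (nhds 0)" and R: "\<And>h. R (?I f h) \<Longrightarrow> Q f h"
      using Q(1)[OF f] by (auto simp: eventually_filtercomap)
    then obtain e where "e > 0" "\<And>x. dist x 0 < e \<Longrightarrow> R x"
      by (auto simp: eventually_nhds_metric)
    with R show ?thesis by (intro exI[of _ e]) auto
  qed
  then obtain e where e: "\<And>f. f \<in> H \<Longrightarrow> e f > 0" "\<And>f h. f \<in> H \<Longrightarrow> \<bar>?I f h\<bar> < e f \<Longrightarrow> Q f h"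
    by metis
  \<comment> \<open>The inserted 1 keeps the minimum meaningful and positive when \<open>H\<close>
    is empty.\<close>
  let ?e = "Min (insert 1 (e ` H))"
  show ?thesis
  proof (rule that[of H ?e])
    show "?e > 0" using H(1) e(1) by (subst Min_gr_iff) auto
    fix h assume h: "h \<in> borel_measurable borel" "\<And>x. \<bar>h x\<bar> \<le> 1" "\<And>f. f \<in> H \<Longrightarrow> \<bar>?I f h\<bar> < ?e"
    have "?I f h < e f \<and> - ?I f h < e f" if "f \<in> H" for f
    proof -
      have "\<bar>?I f h\<bar> < ?e" using h(3) that .
      moreover have "?e \<le> e f" using H(1) that by (intro Min_le) auto
      ultimately show ?thesis by linarith
    qed
    then show "P h" using Q(2)[of h] e(2) h(1,2) by (simp add: abs_less_iff)
  qed (use H in auto)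
qed

section \<open>Quadratic forms with integrable kernels\<close>

definition weak_form :: "('a::euclidean_space \<times> 'a \<Rightarrow> real) \<Rightarrow> ('a \<Rightarrow> real) \<Rightarrow> real" where
  "weak_form K h = (\<integral>p. h (fst p) * h (snd p) * K p \<partial>(lborel \<Otimes>\<^sub>M lborel))"

lemma weak_form_integrable:
  fixes K :: "'a::euclidean_space \<times> 'a \<Rightarrow> real"
  assumes "integrable (lborel \<Otimes>\<^sub>M lborel) K" "h \<in> borel_measurable borel" "\<And>x. \<bar>h x\<bar> \<le> 1"
  shows "integrable (lborel \<Otimes>\<^sub>M lborel) (\<lambda>p. h (fst p) * h (snd p) * K p)"
proof (rule Bochner_Integration.integrable_bound[OF assms(1)])
  have [measurable]: "h \<in> borel_measurable lborel" "K \<in> borel_measurable (lborel \<Otimes>\<^sub>M lborel)"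
    using assms by auto
  show "(\<lambda>p. h (fst p) * h (snd p) * K p) \<in> borel_measurable (lborel \<Otimes>\<^sub>M lborel)"
    by measurable
  have "\<bar>h x * h y * K (x, y)\<bar> \<le> 1 * 1 * \<bar>K (x, y)\<bar>" for x y
    unfolding abs_mult using assms(3) by (intro mult_mono) auto
  then show "AE p in lborel \<Otimes>\<^sub>M lborel. norm (h (fst p) * h (snd p) * K p) \<le> norm (K p)"
    by auto
qed

text \<open>As h is bounded by 1, the forms of two kernels differ by at most the L^1 distance of the
  kernels, uniformly in h. Dominated convergence makes that distance small. This is the limit step
  of both inductions below, over sets and over functions.\<close>

lemma tendsto_weak_form_dominated:
  fixes K :: "'a::euclidean_space \<times> 'a \<Rightarrow> real"
  assumes lim: "\<And>p. (\<lambda>n. k n p) \<longlonglongrightarrow> K p"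
    and dom: "\<And>n p. \<bar>k n p\<bar> \<le> w p" and w: "integrable (lborel \<Otimes>\<^sub>M lborel) w"
    and k: "\<And>n. integrable (lborel \<Otimes>\<^sub>M lborel) (k n)"
    and t: "\<And>n. (weak_form (k n) \<longlongrightarrow> 0) weak_star_null"
  shows "integrable (lborel \<Otimes>\<^sub>M lborel) K" "(weak_form K \<longlongrightarrow> 0) weak_star_null"
proof -
  have [measurable]: "k n \<in> borel_measurable (lborel \<Otimes>\<^sub>M lborel)" for n using k by auto
  have [measurable]: "K \<in> borel_measurable (lborel \<Otimes>\<^sub>M lborel)"
    by (rule borel_measurable_LIMSEQ_real[of _ k]) (use lim in auto)
  have domK: "\<bar>K p\<bar> \<le> w p" for p
    using LIMSEQ_le_const2[OF tendsto_rabs[OF lim[of p]], of "w p"] dom by auto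
  show K: "integrable (lborel \<Otimes>\<^sub>M lborel) K"
  proof (rule Bochner_Integration.integrable_bound[OF w])
    have "norm (K p) \<le> norm (w p)" for p using domK[of p] by simp
    then show "AE p in lborel \<Otimes>\<^sub>M lborel. norm (K p) \<le> norm (w p)" by simp
  qed simp
  have "(\<lambda>n. \<integral>p. \<bar>k n p - K p\<bar> \<partial>(lborel \<Otimes>\<^sub>M lborel)) \<longlonglongrightarrow> (\<integral>p. 0 \<partial>((lborel::'a measure) \<Otimes>\<^sub>M (lborel::'a measure)))"
  proof (rule integral_dominated_convergence[where w="\<lambda>p. 2 * w p"])
    show "AE p in lborel \<Otimes>\<^sub>M lborel. (\<lambda>n. \<bar>k n p - K p\<bar>) \<longlonglongrightarrow> 0"
      using lim by (auto intro!: tendsto_rabs_zero simp: LIM_zero_iff)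
    show "AE p in lborel \<Otimes>\<^sub>M lborel. norm \<bar>k n p - K p\<bar> \<le> 2 * w p" for n
      by (intro AE_I2) (use dom[of n] domK in \<open>smt (verit) real_norm_def\<close>)
  qed (use w in auto)
  then have L1: "(\<lambda>n. \<integral>p. \<bar>k n p - K p\<bar> \<partial>(lborel \<Otimes>\<^sub>M lborel)) \<longlonglongrightarrow> 0" by simp
  show "(weak_form K \<longlongrightarrow> 0) weak_star_null"
  proof (rule tendstoI)
    fix \<epsilon> :: real assume "\<epsilon> > 0"
    \<comment> \<open>The index is fixed before h appears; the L^1 bound then serves every
      admissible h at once.\<close>
    then obtain n where n: "(\<integral>p. \<bar>k n p - K p\<bar> \<partial>(lborel \<Otimes>\<^sub>M lborel)) < \<epsilon> / 2"
      using order_tendstoD(2)[OF L1, of "\<epsilon>/2"] eventually_happens sequentially_bot by fastforce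
    have "eventually (\<lambda>h. dist (weak_form (k n) h) 0 < \<epsilon> / 2) weak_star_null"
      using tendstoD[OF t half_gt_zero[OF \<open>\<epsilon> > 0\<close>]] .
    then show "eventually (\<lambda>h. dist (weak_form K h) 0 < \<epsilon>) weak_star_null"
      using eventually_weak_star_null_bounded
    proof eventually_elim
      case (elim h)
      then have h: "h \<in> borel_measurable borel" "\<And>x. \<bar>h x\<bar> \<le> 1" by auto
      have "weak_form (k n) h - weak_form K h = weak_form (\<lambda>p. k n p - K p) h"
        unfolding weak_form_def
        using Bochner_Integration.integral_diff[OF weak_form_integrable[OF k h, of n] weak_form_integrable[OF K h]]
        by (simp add: algebra_simps)
      also have "\<bar>\<dots>\<bar> \<le> (\<integral>p. \<bar>k n p - K p\<bar> \<partial>(lborel \<Otimes>\<^sub>M lborel))"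
      proof -
        have i: "integrable (lborel \<Otimes>\<^sub>M lborel) (\<lambda>p. k n p - K p)" using K k by auto
        have b: "\<bar>h x * h y * c\<bar> \<le> 1 * 1 * \<bar>c\<bar>" for x y c
          unfolding abs_mult using h(2) by (intro mult_mono) auto
        show ?thesis
          unfolding weak_form_def
          by (rule order_trans[OF integral_abs_bound integral_mono])
            (use weak_form_integrable[OF i h] i b in auto)
      qed
      finally show ?case using elim(1) n by (auto simp: dist_real_def)
    qed
  qed
qed

text \<open>The form is a product of two linear functionals of h, each the pairing with one
  integrable indicator. Within this section only this case uses the definition of weak-* smallness;
  all others reduce to it.\<close>

lemma weak_form_rectangle:
  fixes A B :: "'a::euclidean_space set"
  assumes "A \<in> sets borel" "B \<in> sets borel" "emeasure lborel A < \<infinity>" "emeasure lborel B < \<infinity>"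
  shows "(weak_form (indicator (A \<times> B)) \<longlongrightarrow> 0) weak_star_null"
proof -
  have iA: "integrable lborel (indicator A :: 'a \<Rightarrow> real)" "integrable lborel (indicator B :: 'a \<Rightarrow> real)"
    using assms by (auto simp: integrable_indicator_iff)
  have "((\<lambda>h. (\<integral>x. h x * indicator A x \<partial>lborel) * (\<integral>x. h x * indicator B x \<partial>lborel)) \<longlongrightarrow> 0 * 0) weak_star_null"
    by (intro tendsto_mult tendsto_weak_star_null iA)
  moreover have "eventually (\<lambda>h. (\<integral>x. h x * indicator A x \<partial>lborel) * (\<integral>x. h x * indicator B x \<partial>lborel)
     = weak_form (indicator (A \<times> B)) h) weak_star_null"
    using eventually_weak_star_null_bounded
  proof eventually_elim
    case (elim h)
    have i: "integrable (lborel \<Otimes>\<^sub>M lborel) (indicator (A \<times> B) :: 'a \<times> 'a \<Rightarrow> real)"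
      using assms by (auto simp: integrable_indicator_iff lborel.emeasure_pair_measure_Times ennreal_mult_less_top)
    have "weak_form (indicator (A \<times> B)) h = (\<integral>x. \<integral>y. h x * h y * indicator (A \<times> B) (x, y) \<partial>lborel \<partial>lborel)"
      unfolding weak_form_def
      by (subst lborel_pair.integral_fst'[symmetric]) (use weak_form_integrable[OF i] elim in auto)
    also have "\<dots> = (\<integral>x. \<integral>y. (h x * indicator A x) * (h y * indicator B y) \<partial>lborel \<partial>lborel)"
      by (intro Bochner_Integration.integral_cong) (auto simp: indicator_def)
    finally show ?case by simp
  qed
  ultimately show ?thesis
    by (simp add: tendsto_cong)
qed

lemma weak_form_add:
  assumes "integrable (lborel \<Otimes>\<^sub>M lborel) K" "integrable (lborel \<Otimes>\<^sub>M lborel) L"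
    "(weak_form K \<longlongrightarrow> 0) weak_star_null" "(weak_form L \<longlongrightarrow> 0) weak_star_null"
  shows "(weak_form (\<lambda>p. K p + c * L p) \<longlongrightarrow> 0) weak_star_null"
proof -
  have "((\<lambda>h. weak_form K h + c * weak_form L h) \<longlongrightarrow> 0 + c * 0) weak_star_null"
    by (intro tendsto_intros assms)
  moreover have "eventually (\<lambda>h. weak_form K h + c * weak_form L h = weak_form (\<lambda>p. K p + c * L p) h) weak_star_null"
    using eventually_weak_star_null_bounded
  proof eventually_elim
    case (elim h)
    then have "integrable (lborel \<Otimes>\<^sub>M lborel) (\<lambda>p. h (fst p) * h (snd p) * K p)"
       "integrable (lborel \<Otimes>\<^sub>M lborel) (\<lambda>p. c * (h (fst p) * h (snd p) * L p))"
      using weak_form_integrable[OF assms(1)] weak_form_integrable[OF assms(2)] by auto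
    from Bochner_Integration.integral_add[OF this] show ?case
      by (simp add: weak_form_def algebra_simps)
  qed
  ultimately show ?thesis by (simp add: tendsto_cong)
qed

text \<open>Rectangles are stable under intersection and generate the product sigma-algebra, so
  closure under complements and disjoint unions suffices. The cutoff to C x C is what makes
  complements harmless: the complement of a set may have infinite measure, its part inside C x C
  does not.\<close>

lemma weak_form_indicator_Int:
  fixes C :: "'a::euclidean_space set"
  assumes C: "C \<in> sets borel" "emeasure lborel C < \<infinity>" and E: "E \<in> sets (lborel \<Otimes>\<^sub>M lborel)"
  shows "(weak_form (indicator (E \<inter> C \<times> C)) \<longlongrightarrow> 0) weak_star_null"
proof -
  have CC: "C \<times> C \<in> sets (lborel \<Otimes>\<^sub>M lborel)" using C by auto
  have fin: "emeasure (lborel \<Otimes>\<^sub>M lborel) (C \<times> C) < \<infinity>"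
    using C by (auto simp: lborel.emeasure_pair_measure_Times ennreal_mult_less_top)
  have int: "integrable (lborel \<Otimes>\<^sub>M lborel) (indicator (A \<inter> C \<times> C) :: 'a \<times> 'a \<Rightarrow> real)"
    if "A \<in> sets (lborel \<Otimes>\<^sub>M lborel)" for A
    using that CC fin by (auto simp: integrable_indicator_iff intro: le_less_trans[OF emeasure_mono])
  have gen: "{a \<times> b |a b. a \<in> sets (lborel::'a measure) \<and> b \<in> sets (lborel::'a measure)} \<subseteq> Pow UNIV"
    "Int_stable {a \<times> b |a b. a \<in> sets (lborel::'a measure) \<and> b \<in> sets (lborel::'a measure)}"
    using Int_stable_pair_measure_generator[of lborel lborel] by auto
  have "E \<in> sigma_sets UNIV {a \<times> b |a b. a \<in> sets (lborel::'a measure) \<and> b \<in> sets (lborel::'a measure)}"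
    using E by (simp add: sets_pair_measure)
  from gen(2,1) this show ?thesis
  proof (induction rule: sigma_sets_induct_disjoint)
    case (basic A)
    then obtain a b where ab: "A = a \<times> b" "a \<in> sets borel" "b \<in> sets borel" by auto
    have "A \<inter> C \<times> C = (a \<inter> C) \<times> (b \<inter> C)" using ab by auto
    then show ?case using ab C
      by (auto intro!: weak_form_rectangle intro: le_less_trans[OF emeasure_mono])
  next
    case empty
    show ?case by (simp add: weak_form_def)
  next
    case (compl A)
    then have A: "A \<in> sets (lborel \<Otimes>\<^sub>M lborel)" by (simp add: sets_pair_measure)
    have "UNIV \<in> sets (lborel \<Otimes>\<^sub>M (lborel::'a measure))"
      using sets.top[of "lborel \<Otimes>\<^sub>M (lborel::'a measure)"] by (simp add: space_pair_measure)
    then have "(weak_form (\<lambda>p. indicator (UNIV \<inter> C \<times> C) p + (-1) * indicator (A \<inter> C \<times> C) p) \<longlongrightarrow> 0) weak_star_null"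
      using A C int[of UNIV] weak_form_rectangle[of C C] by (intro weak_form_add int compl) auto
    also have "(\<lambda>p. indicator (UNIV \<inter> C \<times> C) p + (-1) * indicator (A \<inter> C \<times> C) p :: real) = indicator ((UNIV - A) \<inter> C \<times> C)"
      by (auto simp: fun_eq_iff indicator_def)
    finally show ?case .
  next
    case (union A)
    have A: "A i \<in> sets (lborel \<Otimes>\<^sub>M lborel)" for i
      using union(2) by (auto simp: sets_pair_measure)
    let ?A = "\<lambda>n. (\<Union>i<n. A i)"
    show ?case
    proof (rule tendsto_weak_form_dominated(2)[where k="\<lambda>n. indicator (?A n \<inter> C \<times> C)" and w="indicator (UNIV \<inter> C \<times> C)"])
      show "(\<lambda>n. indicator (?A n \<inter> C \<times> C) p) \<longlonglongrightarrow> (indicator ((\<Union>i. A i) \<inter> C \<times> C) p::real)" for p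
        using LIMSEQ_indicator_UN[of "\<lambda>i. A i \<inter> C \<times> C" p] by (simp add: Int_UN_distrib2[symmetric])
      show "(weak_form (indicator (?A n \<inter> C \<times> C)) \<longlongrightarrow> 0) weak_star_null" for n
      proof (induction n)
        case 0
        then show ?case by (simp add: weak_form_def)
      next
        case (Suc n)
        have "(weak_form (\<lambda>p. indicator (?A n \<inter> C \<times> C) p + 1 * indicator (A n \<inter> C \<times> C) p) \<longlongrightarrow> 0) weak_star_null"
          using Suc union(3) A by (intro weak_form_add int) auto
        also have "(\<lambda>p. indicator (?A n \<inter> C \<times> C) p + 1 * indicator (A n \<inter> C \<times> C) p :: real) = indicator (?A (Suc n) \<inter> C \<times> C)"
        proof -
          have "?A n \<inter> A n = {}" using union(1) unfolding disjoint_family_on_def by (blast dest: less_imp_neq)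
          then have "\<And>p. indicator (?A n \<inter> A n \<inter> C \<times> C) p = (0::real)" by simp
          then show ?thesis by (auto simp: fun_eq_iff indicator_def lessThan_Suc split: if_splits)
        qed
        finally show ?case .
      qed
      have "UNIV \<in> sets (lborel \<Otimes>\<^sub>M (lborel::'a measure))"
        using sets.top[of "lborel \<Otimes>\<^sub>M (lborel::'a measure)"] by (simp add: space_pair_measure)
      then show "integrable (lborel \<Otimes>\<^sub>M lborel) (indicator (UNIV \<inter> C \<times> C) :: 'a \<times> 'a \<Rightarrow> real)"
        by (rule int)
      show "integrable (lborel \<Otimes>\<^sub>M lborel) (indicator (?A n \<inter> C \<times> C) :: 'a \<times> 'a \<Rightarrow> real)" for n
        by (intro int sets.finite_UN A) auto
    qed (auto simp: indicator_def)
  qed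
qed

text \<open>The cutoff is removed by exhausting a set of finite measure with squares of growing
  balls; linearity and L^1 approximation by simple functions do the rest.\<close>

lemma weak_form_tendsto:
  fixes K :: "'a::euclidean_space \<times> 'a \<Rightarrow> real"
  assumes "integrable (lborel \<Otimes>\<^sub>M lborel) K"
  shows "(weak_form K \<longlongrightarrow> 0) weak_star_null"
  using assms
proof (induction rule: integrable_induct)
  case (base A c)
  let ?C = "\<lambda>n::nat. ball (0::'a) (real n)"
  have "(weak_form (\<lambda>p. 0 + c * indicator A p) \<longlongrightarrow> 0) weak_star_null"
  proof (rule weak_form_add)
    show "(weak_form (indicator A) \<longlongrightarrow> 0) weak_star_null"
    proof (rule tendsto_weak_form_dominated(2)[where k="\<lambda>n. indicator (A \<inter> ?C n \<times> ?C n)" and w="indicator A"])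
      show "(\<lambda>n. indicator (A \<inter> ?C n \<times> ?C n) p) \<longlonglongrightarrow> (indicator A p::real)" for p
      proof -
        obtain N :: nat where N: "max (norm (fst p)) (norm (snd p)) < real N"
          using reals_Archimedean2 by blast
        have "eventually (\<lambda>n. indicator A p = (indicator (A \<inter> ?C n \<times> ?C n) p::real)) sequentially"
          using eventually_ge_at_top[of N]
          by eventually_elim (use N in \<open>auto simp: indicator_def mem_Times_iff\<close>)
        then show ?thesis by (rule Lim_transform_eventually[rotated]) simp
      qed
      show "(weak_form (indicator (A \<inter> ?C n \<times> ?C n)) \<longlongrightarrow> 0) weak_star_null" for n
        using base by (intro weak_form_indicator_Int) (auto intro: emeasure_lborel_ball_finite[simplified])
      show "integrable (lborel \<Otimes>\<^sub>M lborel) (indicator (A \<inter> ?C n \<times> ?C n) :: 'a \<times> 'a \<Rightarrow> real)" for n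
      proof (rule integrable_real_indicator)
        show "A \<inter> ?C n \<times> ?C n \<in> sets (lborel \<Otimes>\<^sub>M lborel)" using base by auto
        show "emeasure (lborel \<Otimes>\<^sub>M lborel) (A \<inter> ?C n \<times> ?C n) < \<infinity>"
          by (rule le_less_trans[OF emeasure_mono[OF Int_lower1]]) (use base in auto)
      qed
    qed (use base in \<open>auto simp: indicator_def integrable_indicator_iff\<close>)
  qed (use base in \<open>auto simp: weak_form_def[abs_def] integrable_indicator_iff\<close>)
  then show ?case by (simp add: mult.commute)
next
  case (add f g)
  then show ?case using weak_form_add[of f g 1] by simp
next
  case (lim f s)
  have pt: "\<And>p. (\<lambda>n. s n p) \<longlonglongrightarrow> f p" "\<And>n p. \<bar>s n p\<bar> \<le> 2 * \<bar>f p\<bar>"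
    using lim.hyps(2,3) by (auto simp: space_pair_measure)
  have w: "integrable (lborel \<Otimes>\<^sub>M lborel) (\<lambda>p. 2 * \<bar>f p\<bar>)"
    using lim.hyps(4) by simp
  show ?case
    by (rule tendsto_weak_form_dominated(2)[OF pt w lim.hyps(1) lim.IH])
qed

text \<open>The Radon-Nikodym density of \<open>L\<close> is an admissible kernel: its L^1 norm is
  the total mass of \<open>L\<close>, which is finite.\<close>

lemma tendsto_measure_form:
  fixes L :: "('a::euclidean_space \<times> 'a) measure"
  assumes fin: "finite_measure L" and ac: "absolutely_continuous (lborel \<Otimes>\<^sub>M lborel) L"
    and sets: "sets L = sets (lborel \<Otimes>\<^sub>M lborel)"
  shows "((\<lambda>h. \<integral>p. h (fst p) * h (snd p) \<partial>L) \<longlongrightarrow> 0) weak_star_null"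
proof -
  interpret L: finite_measure L by fact
  note sf = lborel_pair.sigma_finite_measure_axioms[where ?'a='a and ?'b='a]
  obtain D where D: "D \<in> borel_measurable (lborel \<Otimes>\<^sub>M lborel)"
    "AE x in lborel \<Otimes>\<^sub>M lborel. RN_deriv (lborel \<Otimes>\<^sub>M lborel) L x = ennreal (D x)" "\<And>x. 0 \<le> D x"
    using sigma_finite_measure.real_RN_deriv[OF sf fin ac sets] by metis
  note [measurable] = D(1)
  have L: "L = density (lborel \<Otimes>\<^sub>M lborel) (\<lambda>x. ennreal (D x))"
    by (subst sigma_finite_measure.density_RN_deriv[OF sf ac sets, symmetric]) (intro density_cong D, auto)
  have "(\<integral>\<^sup>+ p. ennreal (D p) \<partial>(lborel \<Otimes>\<^sub>M lborel)) = emeasure L (space L)"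
    unfolding sets_eq_imp_space_eq[OF sets]
    by (subst L, subst emeasure_density[OF _ sets.top]) (auto intro!: nn_integral_cong)
  then have "integrable (lborel \<Otimes>\<^sub>M lborel) D"
    using D by (intro integrableI_nonneg) (auto simp: L.emeasure_eq_measure)
  then have "(weak_form D \<longlongrightarrow> 0) weak_star_null"
    by (rule weak_form_tendsto)
  moreover have "eventually (\<lambda>h. weak_form D h = (\<integral>p. h (fst p) * h (snd p) \<partial>L)) weak_star_null"
    using eventually_weak_star_null_bounded
  proof eventually_elim
    case (elim h)
    then have [measurable]: "h \<in> borel_measurable lborel" by simp
    show ?case unfolding weak_form_def
      by (subst L, subst integral_real_density) (use D(3) in \<open>auto simp: mult.commute\<close>)
  qed
  ultimately show ?thesis by (simp add: tendsto_cong)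
qed

section \<open>Shears and mean squares of averages\<close>

lemma AE_lborel_translation:
  fixes c :: "'a::euclidean_space"
  assumes "AE x in lborel. P x"
  shows "AE x in lborel. P (c + x)"
proof -
  obtain N where N: "{x. \<not> P x} \<subseteq> N" "N \<in> sets borel" "emeasure lborel N = 0"
    using AE_E[OF assms] by auto
  have "AE x in distr lborel borel ((+) c). x \<notin> N"
    using N unfolding lborel_distr_plus by (intro AE_not_in) auto
  then have "AE x in lborel. c + x \<notin> N"
    using N by (subst (asm) AE_distr_iff) auto
  then show ?thesis by eventually_elim (use N in auto)
qed

text \<open>Fubini for the coordinates (u, v - u): on almost every u-section translation by u
  preserves null sets, and exchanging the two quantifiers puts the difference outside.\<close>

lemma AE_shear:
  fixes N :: "('a::euclidean_space \<times> 'a) set"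
  assumes "N \<in> null_sets (lborel \<Otimes>\<^sub>M lborel)"
  shows "AE c in lborel. AE u in lborel. (u, u + c) \<notin> N"
proof -
  have [measurable]: "N \<in> sets (borel \<Otimes>\<^sub>M borel)" using assms by auto
  have "AE p in lborel \<Otimes>\<^sub>M lborel. p \<notin> N" using assms by (rule AE_not_in)
  from lborel_pair.AE_pair[OF this] have "AE u in lborel. AE v in lborel. (u, v) \<notin> N" .
  then have "AE u in lborel. AE c in lborel. (u, u + c) \<notin> N"
    by eventually_elim (rule AE_lborel_translation)
  moreover have "{p \<in> space (lborel \<Otimes>\<^sub>M lborel). (fst p, fst p + snd p) \<notin> N} \<in> sets (lborel \<Otimes>\<^sub>M lborel)"
    by measurable
  ultimately show ?thesis
    by (simp add: lborel_pair.AE_commute[of "\<lambda>u c. (u, u + c) \<notin> N"])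
qed

text \<open>Expanding the square gives the integral of h(u) h(v) against the law of
  (u,v) = (x + a(\<xi>,\<omega>), x + a(\<xi>,\<omega>')), which is absolutely continuous since x and v - u are.\<close>

lemma squared_average_tendsto:
  fixes a :: "'b \<times> 'c \<Rightarrow> 'a::euclidean_space" and \<Xi> :: "'b measure" and \<Omega> :: "'c measure"
  assumes "prob_space \<Xi>" "prob_space \<Omega>"
    and a[measurable]: "a \<in> borel_measurable (\<Xi> \<Otimes>\<^sub>M \<Omega>)"
    and B[measurable]: "B \<in> sets borel" and Bfin: "emeasure lborel B < \<infinity>"
    and ac: "\<And>N. N \<in> null_sets lborel \<Longrightarrow> AE \<xi> in \<Xi>. AE \<omega> in \<Omega>. AE \<omega>' in \<Omega>. a (\<xi>, \<omega>') - a (\<xi>, \<omega>) \<notin> N"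
  shows "((\<lambda>h. \<integral>x. indicator B x * (\<integral>\<xi>. (\<integral>\<omega>. h (x + a (\<xi>, \<omega>)) \<partial>\<Omega>)\<^sup>2 \<partial>\<Xi>) \<partial>lborel) \<longlongrightarrow> 0) weak_star_null"
proof -
  interpret \<Xi>: prob_space \<Xi> by fact
  interpret \<Omega>: prob_space \<Omega> by fact
  interpret \<Omega>\<Omega>: pair_prob_space \<Omega> \<Omega> ..
  interpret P: pair_prob_space \<Xi> "\<Omega> \<Otimes>\<^sub>M \<Omega>" ..
  \<comment> \<open>Lebesgue measure cut down to \<open>B\<close>, so that all measures in the
    product are finite and bounded functions are integrable.\<close>
  define X where "X = density lborel (\<lambda>x. ennreal (indicator B x))"
  have X: "sets X = sets borel" "space X = UNIV" by (simp_all add: X_def)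
  have [measurable_cong]: "sets X = sets borel" by fact
  interpret X: finite_measure X
    using Bfin by (intro finite_measureI) (simp add: X_def emeasure_density ennreal_indicator less_top)
  let ?P = "\<Xi> \<Otimes>\<^sub>M (\<Omega> \<Otimes>\<^sub>M \<Omega>)"
  interpret Y: pair_sigma_finite X ?P ..
  \<comment> \<open>Two independent copies \<omega>, \<omega>' share the same x and \<xi>; this is
    what the square of the inner integral produces.\<close>
  define \<phi> where "\<phi> = (\<lambda>p. (fst p + a (fst (snd p), fst (snd (snd p))), fst p + a (fst (snd p), snd (snd (snd p)))))"
  have \<phi>[measurable]: "\<phi> \<in> X \<Otimes>\<^sub>M ?P \<rightarrow>\<^sub>M borel \<Otimes>\<^sub>M borel"
    unfolding \<phi>_def by measurable
  define L where "L = distr (X \<Otimes>\<^sub>M ?P) (lborel \<Otimes>\<^sub>M lborel) \<phi>"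
  have finY: "finite_measure (X \<Otimes>\<^sub>M ?P)"
    by (intro finite_measure_pair_measure X.finite_measure_axioms P.finite_measure_axioms)
  have "finite_measure L" unfolding L_def by (rule finite_measure.finite_measure_distr[OF finY]) simp
  moreover have "absolutely_continuous (lborel \<Otimes>\<^sub>M lborel) L"
    unfolding absolutely_continuous_def
  proof
    fix N :: "('a \<times> 'a) set" assume N: "N \<in> null_sets (lborel \<Otimes>\<^sub>M lborel)"
    have N'[measurable]: "N \<in> sets (borel \<Otimes>\<^sub>M borel)" using N by auto
    \<comment> \<open>\<open>N0\<close> collects the bad differences v - u. The hypothesis
      \<open>ac\<close> avoids them almost surely, and for a good difference translating x by
      a(\<xi>,\<omega>) finishes the argument.\<close>
    obtain N0 where N0: "{c. \<not> (AE u in lborel. (u, u + c) \<notin> N)} \<subseteq> N0" "N0 \<in> null_sets lborel"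
      using AE_E[OF AE_shear[OF N]] by (auto simp: null_sets_def)
    have [measurable]: "N0 \<in> sets borel" using N0 by auto
    have "AE q in ?P. a (fst q, snd (snd q)) - a (fst q, fst (snd q)) \<notin> N0"
    proof (rule P.AE_pair_measure)
      show "AE \<xi> in \<Xi>. AE w in \<Omega> \<Otimes>\<^sub>M \<Omega>. a (fst (\<xi>, w), snd (snd (\<xi>, w))) - a (fst (\<xi>, w), fst (snd (\<xi>, w))) \<notin> N0"
        using ac[OF N0(2)] AE_space
      proof eventually_elim
        case (elim \<xi>)
        note [measurable] = elim(2)
        show ?case using elim(1) by (intro \<Omega>\<Omega>.AE_pair_measure) auto
      qed
    qed measurable
    then have "AE q in ?P. AE x in X. \<phi> (x, q) \<notin> N"
    proof eventually_elim
      case (elim q)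
      obtain \<xi> \<omega> \<omega>' where q: "q = (\<xi>, (\<omega>, \<omega>'))" by (cases q) auto
      have "AE u in lborel. (u, u + (a (\<xi>, \<omega>') - a (\<xi>, \<omega>))) \<notin> N" using N0(1) elim q by auto
      from AE_lborel_translation[OF this, of "a (\<xi>, \<omega>)"]
      have "AE x in lborel. (x + a (\<xi>, \<omega>), x + a (\<xi>, \<omega>')) \<notin> N"
        by (simp add: algebra_simps)
      then show ?case unfolding X_def \<phi>_def q by (subst AE_density) auto
    qed
    then have "AE x in X. AE q in ?P. \<phi> (x, q) \<notin> N"
      by (subst Y.AE_commute) auto
    then have "AE p in X \<Otimes>\<^sub>M ?P. \<phi> p \<notin> N"
      by (intro Y.AE_pair_measure) auto
    moreover have "{p \<in> space (lborel \<Otimes>\<^sub>M lborel). p \<notin> N} \<in> sets (lborel \<Otimes>\<^sub>M lborel)"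
      by measurable
    moreover have "\<phi> \<in> X \<Otimes>\<^sub>M ?P \<rightarrow>\<^sub>M lborel \<Otimes>\<^sub>M lborel" by simp
    ultimately have "AE p in L. p \<notin> N" unfolding L_def
      by (simp only: AE_distr_iff)
    then show "N \<in> null_sets L" by (subst AE_iff_null_sets) (auto simp: L_def)
  qed
  ultimately have "((\<lambda>h. \<integral>p. h (fst p) * h (snd p) \<partial>L) \<longlongrightarrow> 0) weak_star_null"
    by (rule tendsto_measure_form) (simp add: L_def)
  moreover have "eventually (\<lambda>h. (\<integral>p. h (fst p) * h (snd p) \<partial>L) =
      (\<integral>x. indicator B x * (\<integral>\<xi>. (\<integral>\<omega>. h (x + a (\<xi>, \<omega>)) \<partial>\<Omega>)\<^sup>2 \<partial>\<Xi>) \<partial>lborel)) weak_star_null"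
    using eventually_weak_star_null_bounded
  proof eventually_elim
    case (elim h)
    then have [measurable]: "h \<in> borel_measurable borel" and h1: "\<bar>h x\<bar> \<le> 1" for x by auto
    have hh: "\<bar>h x * h y\<bar> \<le> 1" for x y
      using mult_mono[OF h1[of x] h1[of y]] by (simp add: abs_mult)
    have "(\<integral>p. h (fst p) * h (snd p) \<partial>L) = (\<integral>p. h (fst (\<phi> p)) * h (snd (\<phi> p)) \<partial>(X \<Otimes>\<^sub>M ?P))"
      unfolding L_def by (subst integral_distr) auto
    also have "\<dots> = (\<integral>x. \<integral>q. h (fst (\<phi> (x, q))) * h (snd (\<phi> (x, q))) \<partial>?P \<partial>X)"
    proof (rule Y.integral_fst'[symmetric])
      show "integrable (X \<Otimes>\<^sub>M ?P) (\<lambda>p. h (fst (\<phi> p)) * h (snd (\<phi> p)))"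
        by (rule finite_measure.integrable_const_bound[OF finY, where B=1]) (auto intro: hh)
    qed
    also have "\<dots> = (\<integral>x. \<integral>q. h (x + a (fst q, fst (snd q))) * h (x + a (fst q, snd (snd q))) \<partial>?P \<partial>X)"
      by (simp add: \<phi>_def)
    also have "\<dots> = (\<integral>x. \<integral>\<xi>. \<integral>w. h (x + a (\<xi>, fst w)) * h (x + a (\<xi>, snd w)) \<partial>(\<Omega> \<Otimes>\<^sub>M \<Omega>) \<partial>\<Xi> \<partial>X)"
    proof (rule Bochner_Integration.integral_cong[OF refl])
      fix x
      have "integrable ?P (\<lambda>q. h (x + a (fst q, fst (snd q))) * h (x + a (fst q, snd (snd q))))"
        by (rule P.integrable_const_bound[where B=1]) (auto intro: hh)
      from P.integral_fst'[OF this, symmetric]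
      show "(\<integral>q. h (x + a (fst q, fst (snd q))) * h (x + a (fst q, snd (snd q))) \<partial>?P)
        = (\<integral>\<xi>. \<integral>w. h (x + a (\<xi>, fst w)) * h (x + a (\<xi>, snd w)) \<partial>(\<Omega> \<Otimes>\<^sub>M \<Omega>) \<partial>\<Xi>)" by simp
    qed
    also have "\<dots> = (\<integral>x. \<integral>\<xi>. \<integral>\<omega>. \<integral>\<omega>'. h (x + a (\<xi>, \<omega>)) * h (x + a (\<xi>, \<omega>')) \<partial>\<Omega> \<partial>\<Omega> \<partial>\<Xi> \<partial>X)"
    proof (intro Bochner_Integration.integral_cong refl)
      fix x \<xi> assume [measurable]: "\<xi> \<in> space \<Xi>"
      have "integrable (\<Omega> \<Otimes>\<^sub>M \<Omega>) (\<lambda>w. h (x + a (\<xi>, fst w)) * h (x + a (\<xi>, snd w)))"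
        by (rule \<Omega>\<Omega>.integrable_const_bound[where B=1]) (auto intro: hh)
      from \<Omega>\<Omega>.integral_fst'[OF this, symmetric]
      show "(\<integral>w. h (x + a (\<xi>, fst w)) * h (x + a (\<xi>, snd w)) \<partial>(\<Omega> \<Otimes>\<^sub>M \<Omega>))
        = (\<integral>\<omega>. \<integral>\<omega>'. h (x + a (\<xi>, \<omega>)) * h (x + a (\<xi>, \<omega>')) \<partial>\<Omega> \<partial>\<Omega>)" by simp
    qed
    also have "\<dots> = (\<integral>x. \<integral>\<xi>. (\<integral>\<omega>. h (x + a (\<xi>, \<omega>)) \<partial>\<Omega>)\<^sup>2 \<partial>\<Xi> \<partial>X)"
      by (simp add: power2_eq_square)
    also have "\<dots> = (\<integral>x. indicator B x * (\<integral>\<xi>. (\<integral>\<omega>. h (x + a (\<xi>, \<omega>)) \<partial>\<Omega>)\<^sup>2 \<partial>\<Xi>) \<partial>lborel)"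
      unfolding X_def by (subst integral_real_density) auto
    finally show ?case .
  qed
  ultimately show ?thesis by (simp add: tendsto_cong)
qed

section \<open>Averages over circles and segments\<close>

definition cis2 :: "real \<Rightarrow> pt" where
  "cis2 t = vector [cos t, sin t]"

lemma cis2_nth [simp]: "cis2 t $ 1 = cos t" "cis2 t $ 2 = sin t"
  by (simp_all add: cis2_def)

text \<open>Angles are reduced modulo pi and not 2 pi, because \<open>arctan\<close> and
  \<open>arcsin\<close> take values in an interval of length pi; the lost sign is carried
  separately.\<close>

lemma int_multiple_pi_shift:
  obtains k :: int where "- (pi / 2) \<le> t - of_int k * pi" "t - of_int k * pi < pi / 2"
proof -
  obtain k :: int where k: "of_int k \<le> t / pi + 1 / 2" "t / pi + 1 / 2 < of_int k + 1"
    using floor_exists[of "t / pi + 1 / 2"] by auto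
  show ?thesis
    by (rule that[of k]) (use k in \<open>auto simp: field_simps\<close>)
qed

text \<open>The preimage is covered by the lines where polar coordinates degenerate and countably many
  images of N under differentiable local inverses.\<close>

lemma negligible_polar_vimage:
  fixes N :: "pt set"
  assumes "negligible N"
  shows "negligible {p :: real \<times> real. fst p *\<^sub>R cis2 (snd p) \<in> N}"
proof -
  \<comment> \<open>These horizontal lines contain all points whose angle has cosine 0, where the
    quotient v$2 / v$1 is unusable.\<close>
  define H where "H k = {p :: real \<times> real. (0, 1) \<bullet> p = of_int k * (pi / 2)}" for k :: int
  have "negligible (H k)" for k
    unfolding H_def by (rule negligible_hyperplane) (simp add: zero_prod_def)
  moreover
  \<comment> \<open>The inverse branch with sign c of the radius and k half turns of the angle. The
    quotient does not change when v is replaced by -v, so negative radii need no other formula for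
    the angle.\<close>
  define G :: "real \<Rightarrow> int \<Rightarrow> pt \<Rightarrow> real \<times> real" where
    "G c k v = (c * sqrt ((v$1)\<^sup>2 + (v$2)\<^sup>2), arctan (v$2 / v$1) + of_int k * pi)" for c k v
  have "negligible (G c k ` (N \<inter> {v. v$1 \<noteq> 0}))" for c k
  proof (rule negligible_differentiable_image_negligible)
    have "\<exists>D. (G c k has_derivative D) (at v)" if "v$1 \<noteq> 0" for v
    proof -
      have d: "((\<lambda>v::pt. v$i) has_derivative (\<lambda>v. v$i)) (at v)" for i
        by (rule bounded_linear.has_derivative[OF bounded_linear_vec_nth]) simp
      have "(v$1)\<^sup>2 + (v$2)\<^sup>2 > 0"
        using that by (simp add: add_pos_nonneg)
      then show ?thesis unfolding G_def[abs_def] using that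
        by (auto intro!: derivative_eq_intros d)
    qed
    then show "G c k differentiable_on (N \<inter> {v. v$1 \<noteq> 0})"
      unfolding differentiable_on_def differentiable_def by (blast intro: has_derivative_at_withinI)
    show "negligible (N \<inter> {v. v$1 \<noteq> 0})" using assms by (rule negligible_subset) auto
  qed simp
  ultimately have "negligible ({p. (1, 0) \<bullet> p = 0} \<union> (\<Union>k::int. H k) \<union>
      (\<Union>c\<in>{-1, 1}. \<Union>k. G c k ` (N \<inter> {v. v$1 \<noteq> 0})))"
    by (auto simp: zero_prod_def intro!: negligible_Un negligible_hyperplane negligible_countable_Union)
  then show ?thesis
  proof (rule negligible_subset, intro subsetI)
    fix p :: "real \<times> real" assume "p \<in> {p. fst p *\<^sub>R cis2 (snd p) \<in> N}"
    then obtain r t where p: "p = (r, t)" and N: "r *\<^sub>R cis2 t \<in> N" by (cases p) auto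
    consider "r = 0" | "cos t = 0" | "r \<noteq> 0" "cos t \<noteq> 0" by blast
    then show "p \<in> {p. (1, 0) \<bullet> p = 0} \<union> (\<Union>k::int. H k) \<union>
      (\<Union>c\<in>{-1, 1}. \<Union>k. G c k ` (N \<inter> {v. v$1 \<noteq> 0}))"
    proof cases
      case 3
      obtain k :: int where k: "- (pi / 2) \<le> t - of_int k * pi" "t - of_int k * pi < pi / 2"
        by (rule int_multiple_pi_shift)
      have cs: "cos (t - of_int k * pi) = cos t * cos (of_int k * pi)" "sin (t - of_int k * pi) = sin t * cos (of_int k * pi)"
        by (simp_all add: cos_diff sin_diff mult.commute[of _ pi])
      have ck: "cos (of_int k * pi) \<noteq> 0"
        by (simp add: mult.commute[of _ pi])
      \<comment> \<open>\<open>arctan_tan\<close> wants the open interval; the left endpoint would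
        force cos t = 0.\<close>
      have "t - of_int k * pi \<noteq> - (pi / 2)"
        using cs(1) ck 3(2) cos_minus[of "pi/2"] cos_pi_half by (metis mult_eq_0_iff)
      then have "arctan (tan (t - of_int k * pi)) = t - of_int k * pi"
        using k by (intro arctan_tan) auto
      moreover have "tan (t - of_int k * pi) = sin t / cos t"
        unfolding tan_def cs using ck by simp
      ultimately have t: "arctan (sin t / cos t) + of_int k * pi = t" by simp
      have "(r * cos t)\<^sup>2 + (r * sin t)\<^sup>2 = r\<^sup>2"
        by (simp add: power_mult_distrib flip: distrib_left)
      then have "G (sgn r) k (r *\<^sub>R cis2 t) = p"
        using t 3 by (simp add: G_def p sgn_mult_abs)
      moreover have "sgn r \<in> {-1, 1}" using 3 by (auto simp: sgn_if)
      ultimately show ?thesis using N 3 by (intro UnI2 UN_I[of "sgn r"] UN_I[of k]) (auto intro!: image_eqI)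
    qed (auto simp: p H_def cos_zero_iff_int)
  qed
qed

text \<open>The chord from angle s to angle t has polar coordinates
  (2 sin ((t - s) / 2), (s + t + pi) / 2).\<close>

lemma negligible_chord_vimage:
  fixes N :: "pt set"
  assumes "negligible N"
  shows "negligible {p. cis2 (snd p) - cis2 (fst p) \<in> N}"
proof -
  define Z where "Z = {p :: real \<times> real. fst p *\<^sub>R cis2 (snd p) \<in> N}"
  \<comment> \<open>Recovers the half difference u = (t - s) / 2 from the signed chord length 2 sin
    u. The sign c is cos (k pi), from sin (u - k pi) = c sin u. The map \<open>G\<close> below then
    returns both angles from u and the direction.\<close>
  define d where "d c k q = c * arcsin (fst q / 2) + of_int k * pi" for c :: real and k :: int and q :: "real \<times> real"
  define G :: "real \<Rightarrow> int \<Rightarrow> real \<times> real \<Rightarrow> real \<times> real" where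
    "G c k q = (snd q - pi / 2 - d c k q, snd q - pi / 2 + d c k q)" for c k q
  have "negligible (G c k ` (Z \<inter> {q. \<bar>fst q\<bar> < 2}))" for c k
  proof (rule negligible_differentiable_image_negligible)
    have "\<exists>D. (G c k has_derivative D) (at q)" if "\<bar>fst q\<bar> < 2" for q
      unfolding G_def[abs_def] d_def using that
      by (auto intro!: derivative_eq_intros)
    then show "G c k differentiable_on (Z \<inter> {q. \<bar>fst q\<bar> < 2})"
      unfolding differentiable_on_def differentiable_def by (blast intro: has_derivative_at_withinI)
    show "negligible (Z \<inter> {q. \<bar>fst q\<bar> < 2})"
      unfolding Z_def using negligible_polar_vimage[OF assms] by (rule negligible_subset) auto
  qed simp
  \<comment> \<open>The lines t - s = k pi absorb the antipodal pairs, where the chord has length 2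
    and \<open>arcsin\<close> is not differentiable.\<close>
  then have "negligible ((\<Union>k::int. {p. (-1, 1) \<bullet> p = of_int k * pi}) \<union>
      (\<Union>c\<in>{-1, 1}. \<Union>k. G c k ` (Z \<inter> {q. \<bar>fst q\<bar> < 2})))"
    by (auto simp: zero_prod_def intro!: negligible_Un negligible_hyperplane negligible_countable_Union)
  then show ?thesis
  proof (rule negligible_subset, intro subsetI)
    fix p :: "real \<times> real" assume "p \<in> {p. cis2 (snd p) - cis2 (fst p) \<in> N}"
    then obtain s t where p: "p = (s, t)" and N: "cis2 t - cis2 s \<in> N" by (cases p) auto
    define u where "u = (t - s) / 2"
    define w where "w = (s + t) / 2 + pi / 2"
    have st: "s = w - pi / 2 - u" "t = w - pi / 2 + u" by (simp_all add: u_def w_def field_simps)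
    have chord: "cis2 t - cis2 s = (2 * sin u) *\<^sub>R cis2 w"
    proof -
      have "cos t - cos s = 2 * sin u * cos w" "sin t - sin s = 2 * sin u * sin w"
        unfolding st by (simp_all add: cos_add cos_diff sin_add sin_diff algebra_simps)
      then show ?thesis by (simp add: vec_eq_iff forall_2)
    qed
    show "p \<in> (\<Union>k::int. {p. (-1, 1) \<bullet> p = of_int k * pi}) \<union>
      (\<Union>c\<in>{-1, 1}. \<Union>k. G c k ` (Z \<inter> {q. \<bar>fst q\<bar> < 2}))"
    proof (cases "cos u = 0")
      case True
      then obtain n :: int where "u = of_int n * (pi / 2)" by (auto simp: cos_zero_iff_int)
      then have "(-1, 1) \<bullet> p = of_int n * pi" by (simp add: p u_def field_simps)
      then show ?thesis by blast
    next
      case False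
      obtain k :: int where k: "- (pi / 2) \<le> u - of_int k * pi" "u - of_int k * pi \<le> pi / 2"
        by (rule int_multiple_pi_shift) (use less_imp_le in blast)
      define c where "c = cos (of_int k * pi)"
      have c: "c \<in> {-1, 1}" by (auto simp: c_def mult.commute[of _ pi])
      have "sin (u - of_int k * pi) = c * sin u"
        unfolding c_def by (simp add: sin_diff mult.commute[of _ pi])
      then have "arcsin (c * sin u) = u - of_int k * pi" using arcsin_sin[OF k] by simp
      moreover have "arcsin (c * sin u) = c * arcsin (sin u)" using c by (auto simp: arcsin_minus)
      ultimately have "d c k (2 * sin u, w) = u" by (simp add: d_def)
      then have "G c k (2 * sin u, w) = p" by (simp add: G_def p st)
      moreover have "\<bar>sin u\<bar> < 1"
      proof -
        have "(sin u)\<^sup>2 < 1" using False sin_cos_squared_add[of u] by (smt (verit) zero_less_power2)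
        then show ?thesis by (simp add: abs_square_less_1)
      qed
      then have "(2 * sin u, w) \<in> Z \<inter> {q. \<bar>fst q\<bar> < 2}"
        using N chord by (auto simp: Z_def abs_mult)
      ultimately show ?thesis using c by blast
    qed
  qed
qed

section \<open>Arc length and absolutely continuous differences\<close>

lemma borel_measurable_cis2 [measurable]: "cis2 \<in> borel_measurable borel"
proof (rule borel_measurable_continuous_onI)
  have eq: "cis2 = (\<lambda>t. \<chi> i. if i = 1 then cos t else sin t)"
    by (auto simp: fun_eq_iff vec_eq_iff forall_2)
  have "continuous_on UNIV (\<lambda>t::real. if i = 1 then cos t else sin t)" for i :: 2
    by (cases "i = 1") (auto intro!: continuous_intros)
  then have "continuous_on UNIV (\<lambda>t::real. (\<chi> i. if i = 1 then cos t else sin t) :: pt)"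
    by (rule continuous_on_vec_lambda)
  then show "continuous_on UNIV cis2" unfolding eq .
qed

lemma circ_measure_cis2: "circ_measure = distr (uniform_measure lborel {0..2*pi}) borel cis2"
  unfolding circ_measure_def cis2_def[abs_def] ..

lemma sets_circ_measure [simp, measurable_cong]: "sets circ_measure = sets borel"
  by (simp add: circ_measure_def)

lemma space_circ_measure [simp]: "space circ_measure = UNIV"
  by (simp add: circ_measure_def)

lemma prob_space_circ_measure: "prob_space circ_measure"
  unfolding circ_measure_cis2
  by (intro prob_space.prob_space_distr prob_space_uniform_measure) (auto simp: measurable_def[of "uniform_measure _ _"] intro: measurable_sets[OF borel_measurable_cis2, simplified])

lemma AE_circ_measureI:
  assumes P: "Measurable.pred borel P" and ae: "AE t in lborel. P (cis2 t)"
  shows "AE y in circ_measure. P y"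
proof -
  have "AE t in uniform_measure lborel {0..2*pi}. P (cis2 t)"
    using ae by (intro AE_uniform_measureI) auto
  then show ?thesis
    unfolding circ_measure_cis2 using P by (subst AE_distr_iff) auto
qed

text \<open>Replaces a nested almost-everywhere quantifier by the vanishing of an integral, whose
  measurability in the outer variable is automatic. Only then can the outer quantifier move from
  angles to points of the circle.\<close>

lemma AE_nn_integral_indicator_iff:
  assumes "f \<in> borel_measurable M" "N \<in> sets borel"
  shows "(AE x in M. f x \<notin> N) \<longleftrightarrow> (\<integral>\<^sup>+ x. indicator N (f x) \<partial>M) = 0"
  using assms by (subst nn_integral_0_iff_AE) auto

lemma circ_measure_norm_1: "AE y in circ_measure. norm y = 1"
  by (rule AE_circ_measureI) (auto simp: norm_vec_def L2_set_def sum_2)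

lemma AE_lborel_not_in:
  assumes "negligible S" shows "AE x in lborel. x \<notin> S"
  using AE_not_in[of S lebesgue] assms by (simp add: negligible_iff_null_sets AE_completion_iff)

text \<open>By polar coordinates, almost every line through the origin meets N in a set of linear
  measure 0. The difference is (t - s) y, and for each s the shift by -s preserves null sets of the
  line.\<close>

lemma AE_segment_difference:
  fixes N :: "pt set"
  assumes N: "N \<in> null_sets lborel"
  shows "AE y in circ_measure. AE s in uniform_measure lborel {0..1}. AE t in uniform_measure lborel {0..1}.
    t *\<^sub>R y - s *\<^sub>R y \<notin> N"
proof -
  have [measurable]: "N \<in> sets borel" using N by auto
  have "negligible N" using N by (simp add: negligible_iff_null_sets null_sets_completionI)
  then have "AE p in lborel \<Otimes>\<^sub>M lborel. fst p *\<^sub>R cis2 (snd p) \<notin> N"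
    unfolding lborel_prod using AE_lborel_not_in[OF negligible_polar_vimage] by simp
  from lborel_pair.AE_pair[OF this] have "AE r in lborel. AE t in lborel. r *\<^sub>R cis2 t \<notin> N" by simp
  moreover have "{p \<in> space (lborel \<Otimes>\<^sub>M lborel). fst p *\<^sub>R cis2 (snd p) \<notin> N} \<in> sets (lborel \<Otimes>\<^sub>M lborel)"
    by measurable
  ultimately have "AE t in lborel. AE r in lborel. r *\<^sub>R cis2 t \<notin> N"
    by (simp add: lborel_pair.AE_commute[of "\<lambda>r t. r *\<^sub>R cis2 t \<notin> N"])
  then have "AE t in lborel. (\<integral>\<^sup>+ r. indicator N (r *\<^sub>R cis2 t) \<partial>lborel) = 0"
    by (subst (asm) AE_nn_integral_indicator_iff) auto
  then have "AE y in circ_measure. (\<integral>\<^sup>+ r. indicator N (r *\<^sub>R y) \<partial>lborel) = 0"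
    by (intro AE_circ_measureI) auto
  then have "AE y in circ_measure. AE r in lborel. r *\<^sub>R y \<notin> N"
    by (subst AE_nn_integral_indicator_iff) auto
  then show ?thesis
  proof eventually_elim
    case (elim y)
    have shift: "AE t in lborel. t *\<^sub>R y - s *\<^sub>R y \<notin> N" for s
      using AE_lborel_translation[OF elim, of "- s"] by (simp add: algebra_simps)
    have "AE t in uniform_measure lborel {0..1}. t *\<^sub>R y - s *\<^sub>R y \<notin> N" for s
    proof (rule AE_uniform_measureI)
      show "AE t in lborel. t \<in> {0..1} \<longrightarrow> t *\<^sub>R y - s *\<^sub>R y \<notin> N"
        by (rule eventually_mono[OF shift[of s]]) simp
    qed simp
    then show ?case by simp
  qed
qed

text \<open>Follows from the statement about pairs of angles, carried to the circle one variable at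
  a time.\<close>

lemma AE_circle_difference:
  fixes N :: "pt set"
  assumes N: "N \<in> null_sets lborel"
  shows "AE y in circ_measure. AE z in circ_measure. z - y \<notin> N"
proof -
  interpret prob_space circ_measure by (rule prob_space_circ_measure)
  have [measurable]: "N \<in> sets borel" using N by auto
  have "negligible N" using N by (simp add: negligible_iff_null_sets null_sets_completionI)
  then have "AE p in lborel \<Otimes>\<^sub>M lborel. cis2 (snd p) - cis2 (fst p) \<notin> N"
    unfolding lborel_prod using AE_lborel_not_in[OF negligible_chord_vimage] by simp
  from lborel_pair.AE_pair[OF this] have "AE s in lborel. AE t in lborel. cis2 t - cis2 s \<notin> N" by simp
  then have "AE s in lborel. AE z in circ_measure. z - cis2 s \<notin> N"
    by eventually_elim (rule AE_circ_measureI, auto)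
  then have "AE s in lborel. (\<integral>\<^sup>+ z. indicator N (z - cis2 s) \<partial>circ_measure) = 0"
    by (subst (asm) AE_nn_integral_indicator_iff) auto
  then have "AE y in circ_measure. (\<integral>\<^sup>+ z. indicator N (z - y) \<partial>circ_measure) = 0"
    by (intro AE_circ_measureI) auto
  then show ?thesis
    by (subst AE_nn_integral_indicator_iff) auto
qed

lemma circular_average_tendsto:
  fixes B :: "pt set"
  assumes "B \<in> sets borel" "emeasure lborel B < \<infinity>"
  shows "((\<lambda>h. \<integral>x. indicator B x * (\<integral>y. h (x + y) \<partial>circ_measure)\<^sup>2 \<partial>lborel) \<longlongrightarrow> 0) weak_star_null"
proof -
  interpret prob_space circ_measure by (rule prob_space_circ_measure)
  \<comment> \<open>Here the outer space \<Xi> is a dummy: the shift depends on \<omega> alone, and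
    integrating a constant over a probability measure returns it.\<close>
  show ?thesis
    using squared_average_tendsto[where a=snd, OF prob_space_circ_measure prob_space_circ_measure _ assms] AE_circle_difference
    by (simp add: prob_space[unfolded space_circ_measure])
qed

text \<open>The direction y plays the role of the outer variable \<xi>, the position s on the
  segment that of \<omega>.\<close>

lemma segment_average_tendsto:
  fixes B :: "pt set"
  assumes "B \<in> sets borel" "emeasure lborel B < \<infinity>"
  shows "((\<lambda>h. \<integral>x. indicator B x * (\<integral>y. (\<integral>s. h (x + s *\<^sub>R y) \<partial>uniform_measure lborel {0..1})\<^sup>2 \<partial>circ_measure) \<partial>lborel) \<longlongrightarrow> 0) weak_star_null"
proof -
  have "prob_space (uniform_measure lborel {0..1::real})"
    by (intro prob_space_uniform_measure) auto
  moreover have "(\<lambda>p. snd p *\<^sub>R fst p) \<in> borel_measurable (circ_measure \<Otimes>\<^sub>M uniform_measure lborel {0..1::real})"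
    by measurable
  ultimately show ?thesis
    using squared_average_tendsto[where a="\<lambda>p. snd p *\<^sub>R fst p", OF prob_space_circ_measure _ _ assms] AE_segment_difference
    by simp
qed

section \<open>The lower bound\<close>

lemma linear_perp: "linear perp"
  by (rule linearI) (simp_all add: perp_def vec_eq_iff forall_2)

lemma borel_measurable_perp [measurable]: "perp \<in> borel_measurable borel"
  by (intro borel_measurable_continuous_onI linear_continuous_on linear_conv_bounded_linear[THEN iffD1] linear_perp)

lemma norm_perp [simp]: "norm (perp v) = norm v"
  by (simp add: perp_def norm_vec_def L2_set_def sum_2 add.commute)

lemma integrable_indicator_bounded:
  fixes f :: "'a::euclidean_space \<Rightarrow> real"
  assumes [measurable]: "f \<in> borel_measurable borel" "B \<in> sets borel"
    and "emeasure lborel B < \<infinity>" and "\<And>x. \<bar>f x\<bar> \<le> c"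
  shows "integrable lborel (\<lambda>x. indicator B x * f x)"
proof (rule Bochner_Integration.integrable_bound)
  show "integrable lborel (\<lambda>x. c * indicator B x :: real)"
    using assms by (intro integrable_mult_right integrable_real_indicator) auto
  have "norm (indicator B x * f x) \<le> norm (c * indicator B x :: real)" for x
    using assms(4)[of x] by (auto simp: indicator_def)
  then show "AE x in lborel. norm (indicator B x * f x) \<le> norm (c * indicator B x :: real)" by simp
qed simp

lemma lborel_integral_translate:
  fixes f :: "'a::euclidean_space \<Rightarrow> real"
  assumes [measurable]: "f \<in> borel_measurable borel"
  shows "(\<integral>x. f (c + x) \<partial>lborel) = (\<integral>x. f x \<partial>lborel)"
proof -
  have "(\<integral>x. f x \<partial>lborel) = (\<integral>x. f x \<partial>distr lborel borel ((+) c))"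
    by (simp add: lborel_distr_plus)
  also have "\<dots> = (\<integral>x. f (c + x) \<partial>lborel)"
    by (subst integral_distr) auto
  finally show ?thesis by simp
qed

text \<open>A non-integrable f has integral 0 by convention, so the inequality can be applied to
  nested integrals without checking integrability at each level.\<close>

lemma ennreal_integral_le_nn_integral:
  assumes "\<And>x. 0 \<le> f x"
  shows "ennreal (\<integral>x. f x \<partial>M) \<le> (\<integral>\<^sup>+ x. ennreal (f x) \<partial>M)"
  using assms by (cases "integrable M f") (auto simp: nn_integral_eq_integral not_integrable_integral_eq)

lemma (in prob_space) abs_integral_le:
  fixes f :: "'a \<Rightarrow> real"
  assumes "\<And>x. \<bar>f x\<bar> \<le> 1"
  shows "\<bar>\<integral>x. f x \<partial>M\<bar> \<le> 1"
proof (cases "integrable M f")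
  case True
  then have "\<bar>\<integral>x. f x \<partial>M\<bar> \<le> (\<integral>x. 1 \<partial>M)"
    using assms by (intro order_trans[OF integral_abs_bound integral_mono]) auto
  then show ?thesis by (simp add: prob_space)
qed (simp add: not_integrable_integral_eq)

abbreviation "unit_segment \<equiv> uniform_measure lborel {0..1::real}"

lemma prob_space_unit_segment: "prob_space unit_segment"
  by (intro prob_space_uniform_measure) auto

text \<open>After Fubini the parameter y is fixed, and the substitution x -> x - w(y) moves the unit
  ball into the ball of radius 1 + r. The right side no longer contains the shift, only a bound for
  its length.\<close>

lemma integral_translate_family_le:
  fixes q :: "'a::euclidean_space \<times> 'b \<Rightarrow> real" and w :: "'b \<Rightarrow> 'a"
  assumes C: "prob_space C"
    and q[measurable]: "q \<in> borel_measurable (borel \<Otimes>\<^sub>M C)" and q01: "\<And>p. 0 \<le> q p" "\<And>p. q p \<le> 1"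
    and w[measurable]: "w \<in> borel_measurable C" and wr: "AE y in C. norm (w y) \<le> r"
  shows "(\<integral>x. indicator (ball 0 1) x * (\<integral>y. q (x + w y, y) \<partial>C) \<partial>lborel)
    \<le> (\<integral>x. indicator (ball 0 (1 + r)) x * (\<integral>y. q (x, y) \<partial>C) \<partial>lborel)"
proof -
  interpret C: prob_space C by fact
  interpret P: pair_sigma_finite lborel C ..
  have [measurable]: "ball 0 R \<in> sets (borel :: 'a measure)" for R by simp
  \<comment> \<open>Kept general in the shift \<open>v\<close>, since both \<open>w\<close> and the
    zero shift occur.\<close>
  have int: "integrable (lborel \<Otimes>\<^sub>M C) (\<lambda>p. indicator (ball 0 R) (fst p) * q (fst p + v (snd p), snd p))"
    if v: "v \<in> borel_measurable C" for R v
  proof (rule Bochner_Integration.integrable_bound)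
    note [measurable] = v
    have [measurable]: "(\<lambda>p. fst p + v (snd p)) \<in> borel_measurable (lborel \<Otimes>\<^sub>M C)"
      by measurable
    show "(\<lambda>p. indicator (ball 0 R) (fst p) * q (fst p + v (snd p), snd p)) \<in> borel_measurable (lborel \<Otimes>\<^sub>M C)"
      by measurable
    have "emeasure (lborel \<Otimes>\<^sub>M C) (ball 0 R \<times> space C) < \<infinity>"
      by (subst C.emeasure_pair_measure_Times)
        (auto simp: C.emeasure_space_1 emeasure_lborel_ball_finite[simplified])
    then show "integrable (lborel \<Otimes>\<^sub>M C) (indicator (ball 0 R \<times> space C) :: _ \<Rightarrow> real)"
      by (intro integrable_real_indicator) auto
    show "AE p in lborel \<Otimes>\<^sub>M C. norm (indicator (ball 0 R) (fst p) * q (fst p + v (snd p), snd p))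
        \<le> norm (indicator (ball 0 R \<times> space C) p :: real)"
      by (rule AE_I2) (auto simp: indicator_def space_pair_measure q01)
  qed
  have int2: "integrable (lborel \<Otimes>\<^sub>M C) (case_prod (\<lambda>x y. indicator (ball 0 R) x * q (x + v y, y)))"
    if "v \<in> borel_measurable C" for R v
    using int[OF that, of R] by (simp add: case_prod_beta')
  have swap: "(\<integral>x. indicator (ball 0 R) x * (\<integral>y. q (x + v y, y) \<partial>C) \<partial>lborel) =
      (\<integral>y. \<integral>x. indicator (ball 0 R) x * q (x + v y, y) \<partial>lborel \<partial>C)"
    if "v \<in> borel_measurable C" for R v
    using P.Fubini_integral[OF int2[OF that]] by simp
  have int': "integrable C (\<lambda>y. \<integral>x. indicator (ball 0 R) x * q (x + v y, y) \<partial>lborel)"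
    if "v \<in> borel_measurable C" for R v
    using P.integrable_snd[OF int2[OF that]] by simp
  have "(\<integral>y. \<integral>x. indicator (ball 0 1) x * q (x + w y, y) \<partial>lborel \<partial>C)
      \<le> (\<integral>y. \<integral>x. indicator (ball 0 (1 + r)) x * q (x + 0, y) \<partial>lborel \<partial>C)"
  proof (rule integral_mono_AE)
    show "AE y in C. (\<integral>x. indicator (ball 0 1) x * q (x + w y, y) \<partial>lborel)
        \<le> (\<integral>x. indicator (ball 0 (1 + r)) x * q (x + 0, y) \<partial>lborel)"
      using wr AE_space
    proof eventually_elim
      case (elim y)
      note [measurable] = elim(2)
      have "(\<integral>x. indicator (ball 0 1) x * q (x + w y, y) \<partial>lborel) =
          (\<integral>x. indicator (ball 0 1) (- w y + x) * q (- w y + x + w y, y) \<partial>lborel)"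
        by (rule lborel_integral_translate[symmetric]) measurable
      also have "\<dots> \<le> (\<integral>x. indicator (ball 0 (1 + r)) x * q (x + 0, y) \<partial>lborel)"
      proof (rule integral_mono')
        show "integrable lborel (\<lambda>x. indicator (ball 0 (1 + r)) x * q (x + 0, y))"
          by (rule integrable_indicator_bounded[where c=1])
            (use q01 in \<open>auto simp: emeasure_lborel_ball_finite[simplified] abs_le_iff intro: order_trans[of _ 0]\<close>)
        fix x
        have "norm x < 1 + r" if "norm (x - w y) < 1"
          using that elim(1) norm_triangle_sub[of x "w y"] by linarith
        then show "indicator (ball 0 1) (- w y + x) * q (- w y + x + w y, y)
            \<le> indicator (ball 0 (1 + r)) x * q (x + 0, y)"
          using q01 by (auto simp: indicator_def)
        show "0 \<le> indicator (ball 0 (1 + r)) x * q (x + 0, y)" using q01 by auto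
      qed
      finally show ?case .
    qed
  qed (use int'[of "\<lambda>_. 0"] int'[of w] in auto)
  then show ?thesis using swap[of w 1] swap[of "\<lambda>_. 0" "1 + r"] by simp
qed

text \<open>On [0,1] the weight exp (-s) is at least exp (-1), and the uniform measure there is
  Lebesgue measure with normalising constant 1. Everything discarded is nonnegative.\<close>

lemma Tint_lower_bound:
  fixes g :: "pt \<Rightarrow> real"
  assumes [measurable]: "g \<in> borel_measurable borel" "B \<in> sets borel" and g01: "\<And>x. 0 \<le> g x" "\<And>x. g x \<le> 1"
  shows "ennreal (exp (-1) * (\<integral>x. indicator B x * (\<integral>y. g x * g (x + y) *
    (\<integral>s. g (x + (2 * \<alpha>) *\<^sub>R perp y + s *\<^sub>R y) \<partial>unit_segment) \<partial>circ_measure) \<partial>lborel)) \<le> Tint \<alpha> g"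
    (is "ennreal (exp (-1) * ?I) \<le> _")
proof -
  let ?z = "\<lambda>x y s. x + (2 * \<alpha>) *\<^sub>R perp y + s *\<^sub>R y"
  have "exp (-1) * ?I = (\<integral>x. (\<integral>y. (\<integral>s. indicator B x * (exp (-1) * g x * g (x + y) * g (?z x y s)) \<partial>unit_segment) \<partial>circ_measure) \<partial>lborel)"
    by (subst integral_mult_right_zero[symmetric], intro Bochner_Integration.integral_cong refl) (simp add: mult_ac)
  also have "ennreal \<dots> \<le> (\<integral>\<^sup>+x. (\<integral>\<^sup>+y. (\<integral>\<^sup>+s. ennreal (indicator B x * (exp (-1) * g x * g (x + y) * g (?z x y s))) \<partial>unit_segment) \<partial>circ_measure) \<partial>lborel)"
    using g01 by (intro order_trans[OF ennreal_integral_le_nn_integral] nn_integral_mono) auto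
  also have "\<dots> \<le> Tint \<alpha> g"
    unfolding Tint_def
  proof (intro nn_integral_mono)
    fix x y
    have "(\<integral>\<^sup>+s. ennreal (indicator B x * (exp (-1) * g x * g (x + y) * g (?z x y s))) \<partial>unit_segment) =
        (\<integral>\<^sup>+s. ennreal (indicator B x * (exp (-1) * g x * g (x + y) * g (?z x y s))) * indicator {0..1} s \<partial>lborel)"
      by (subst nn_integral_uniform_measure) (auto simp: divide_ennreal_def)
    also have "\<dots> \<le> (\<integral>\<^sup>+s\<in>{0..}. ennreal (exp (- s) * g x * g (x + y) * g (?z x y s)) \<partial>lborel)"
      using g01 by (intro nn_integral_mono) (auto simp: indicator_def intro!: ennreal_leI mult_right_mono)
    finally show "(\<integral>\<^sup>+s. ennreal (indicator B x * (exp (-1) * g x * g (x + y) * g (?z x y s))) \<partial>unit_segment)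
        \<le> (\<integral>\<^sup>+s\<in>{0..}. ennreal (exp (- s) * g x * g (x + y) * g (?z x y s)) \<partial>lborel)" .
  qed
  finally show ?thesis .
qed

lemma abs_le_am_gm:
  fixes e \<eta> :: real
  assumes "\<eta> > 0" shows "\<bar>e\<bar> \<le> (\<eta> + e\<^sup>2 / \<eta>) / 2"
proof -
  have "0 \<le> (\<bar>e\<bar> - \<eta>)\<^sup>2" by simp
  then have "2 * \<bar>e\<bar> * \<eta> \<le> e\<^sup>2 + \<eta>\<^sup>2" by (simp add: power2_diff)
  then show ?thesis using assms by (simp add: field_simps power2_eq_square)
qed

text \<open>The budget behind \<eta>: the main term is at least (3/4) \<delta>^3 b = 3 \<eta> b, and
  each of the four error terms costs at most \<eta> b / 2, so a margin of \<eta> b remains.\<close>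

lemma main_term_dominates:
  fixes b \<delta> \<eta> I X Y :: real
  assumes \<delta>: "0 < \<delta>" "\<delta> \<le> 1" and b: "b > 0" and \<eta>: "\<eta> = \<delta> ^ 3 / 4"
    and I: "\<bar>I\<bar> < b * \<delta> / 4" and X: "X < b * \<eta>\<^sup>2" and Y: "Y < b * \<eta>\<^sup>2"
  shows "\<delta>\<^sup>2 * (\<delta> * b + I) - \<delta> * \<eta> / 2 * b - \<delta> / (2 * \<eta>) * X - \<eta> / 2 * b - 1 / (2 * \<eta>) * Y > 0"
proof -
  have \<eta>0: "\<eta> > 0" unfolding \<eta> using \<delta> by simp
  have "\<delta>\<^sup>2 * (3 / 4 * \<delta> * b) \<le> \<delta>\<^sup>2 * (\<delta> * b + I)"
    using I by (intro mult_left_mono) (auto simp: mult.commute)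
  then have "3 * (\<eta> * b) \<le> \<delta>\<^sup>2 * (\<delta> * b + I)"
    by (simp add: \<eta> power2_eq_square power3_eq_cube)
  moreover have "\<delta> * (\<eta> * b) \<le> \<eta> * b"
    using \<delta> \<eta>0 b by (intro mult_left_le_one_le) auto
  moreover have "\<delta> / (2 * \<eta>) * X \<le> \<eta> * b / 2"
  proof -
    have "\<delta> / (2 * \<eta>) * X \<le> \<delta> / (2 * \<eta>) * (b * \<eta>\<^sup>2)"
      using X \<delta> \<eta>0 by (intro mult_left_mono) auto
    also have "\<dots> = \<delta> * (\<eta> * b) / 2" using \<eta>0 by (simp add: power2_eq_square)
    finally show ?thesis using \<open>\<delta> * (\<eta> * b) \<le> \<eta> * b\<close> by linarith
  qed
  moreover have "1 / (2 * \<eta>) * Y \<le> \<eta> * b / 2"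
  proof -
    have "1 / (2 * \<eta>) * Y \<le> 1 / (2 * \<eta>) * (b * \<eta>\<^sup>2)"
      using Y \<eta>0 by (intro mult_left_mono) auto
    also have "\<dots> = \<eta> * b / 2" using \<eta>0 by (simp add: power2_eq_square)
    finally show ?thesis .
  qed
  moreover have "\<eta> * b > 0" using \<eta>0 b by simp
  ultimately show ?thesis by (simp add: algebra_simps)
qed

text \<open>The factors are replaced from the right: the segment mean F of g by \<delta> at the cost
  |D|, then the circle mean of g by \<delta> at the cost |E|, since the remaining factors lie in
  [0,1]. What is left is \<delta>^2 g(x), whose integral over the ball is controlled by a single
  linear test. None of the three smallness conditions mentions \<alpha>.\<close>

lemma Tint_nonzero:
  fixes g :: "pt \<Rightarrow> real" and \<delta> \<alpha> M :: real
  defines "h \<equiv> \<lambda>x. g x - \<delta>" and "B \<equiv> ball (0::pt) 1" and "\<eta> \<equiv> \<delta> ^ 3 / 4"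
  defines "b \<equiv> measure lborel B"
  assumes g[measurable]: "g \<in> borel_measurable borel" and g01: "\<And>x. 0 \<le> g x" "\<And>x. g x \<le> 1"
    and \<delta>: "0 < \<delta>" "\<delta> \<le> 1" and \<alpha>: "0 < \<alpha>" "\<alpha> \<le> M"
    and h0: "\<bar>\<integral>x. h x * indicator B x \<partial>lborel\<bar> < b * \<delta> / 4"
    and h1: "(\<integral>x. indicator B x * (\<integral>y. h (x + y) \<partial>circ_measure)\<^sup>2 \<partial>lborel) < b * \<eta>\<^sup>2"
    and h2: "(\<integral>x. indicator (ball 0 (1 + 2 * M)) x *
        (\<integral>y. (\<integral>s. h (x + s *\<^sub>R y) \<partial>unit_segment)\<^sup>2 \<partial>circ_measure) \<partial>lborel) < b * \<eta>\<^sup>2"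
  shows "Tint \<alpha> g \<noteq> 0"
proof -
  interpret C: prob_space circ_measure by (rule prob_space_circ_measure)
  interpret U: prob_space unit_segment by (rule prob_space_unit_segment)
  have \<eta>: "\<eta> > 0" using \<delta> by (simp add: \<eta>_def)
  have [measurable]: "B \<in> sets borel" by (simp add: B_def)
  have Bfin: "emeasure lborel B < \<infinity>" by (simp add: B_def emeasure_lborel_ball_finite[simplified])
  have h[measurable]: "h \<in> borel_measurable borel" unfolding h_def by measurable
  have habs: "\<bar>h x\<bar> \<le> 1" for x using g01[of x] \<delta> by (auto simp: h_def abs_le_iff)
  have g_h: "g x = \<delta> + h x" for x by (simp add: h_def)
  define w where "w y = (2 * \<alpha>) *\<^sub>R perp y" for y
  have [measurable]: "w \<in> borel_measurable borel" unfolding w_def by measurable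
  define D where "D x y = (\<integral>s. h (x + w y + s *\<^sub>R y) \<partial>unit_segment)" for x y
  define E where "E x = (\<integral>y. h (x + y) \<partial>circ_measure)" for x
  define Q where "Q x = (\<integral>y. (D x y)\<^sup>2 \<partial>circ_measure)" for x
  define F where "F x y = (\<integral>s. g (x + w y + s *\<^sub>R y) \<partial>unit_segment)" for x y
  have D1: "\<bar>D x y\<bar> \<le> 1" for x y unfolding D_def by (rule U.abs_integral_le) (rule habs)
  have E1: "\<bar>E x\<bar> \<le> 1" for x unfolding E_def by (rule C.abs_integral_le) (rule habs)
  have D2: "\<bar>(D x y)\<^sup>2\<bar> \<le> 1" for x y using D1[of x y] by (simp add: abs_square_le_1)
  have E2: "\<bar>(E x)\<^sup>2\<bar> \<le> 1" for x using E1[of x] by (simp add: abs_square_le_1)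
  have Q1: "\<bar>Q x\<bar> \<le> 1" for x unfolding Q_def by (rule C.abs_integral_le) (rule D2)
  have F_D: "F x y = \<delta> + D x y" for x y
  proof -
    have "integrable unit_segment (\<lambda>s. h (x + w y + s *\<^sub>R y))"
      by (rule U.integrable_const_bound[where B=1]) (use habs in auto)
    then show ?thesis unfolding F_def D_def g_h by (simp add: U.prob_space[simplified])
  qed
  have [measurable]: "E \<in> borel_measurable borel" "Q \<in> borel_measurable borel"
    "(\<lambda>y. D x y) \<in> borel_measurable borel" for x
    unfolding E_def[abs_def] Q_def[abs_def] D_def[abs_def] by measurable
  have intC: "integrable circ_measure f" if "f \<in> borel_measurable borel" "\<And>y. \<bar>f y\<bar> \<le> 1" for f :: "pt \<Rightarrow> real"
    by (rule C.integrable_const_bound[where B=1]) (use that in auto)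
  have mean: "(\<integral>y. g (x + y) \<partial>circ_measure) = \<delta> + E x" for x
  proof -
    have "integrable circ_measure (\<lambda>y. h (x + y))" by (rule intC) (auto simp: habs)
    then show ?thesis unfolding E_def g_h by (simp add: C.prob_space[simplified])
  qed
  have F01: "0 \<le> F x y" "F x y \<le> 1" for x y
  proof -
    show "0 \<le> F x y" unfolding F_def by (simp add: g01)
    have "\<bar>F x y\<bar> \<le> 1" unfolding F_def by (rule U.abs_integral_le) (simp add: g01)
    then show "F x y \<le> 1" by simp
  qed
  \<comment> \<open>Both costs appear in their quadratic form (\<eta> + e^2 / \<eta>) / 2; the one
    for D is already averaged over y, giving Q.\<close>
  define \<Phi> where "\<Phi> x = \<delta> * (\<delta> * g x - (\<eta> + (E x)\<^sup>2 / \<eta>) / 2) - (\<eta> + Q x / \<eta>) / 2" for x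
  have gg: "0 \<le> g x * g y" "g x * g y \<le> 1" for x y
    using g01 by (auto intro: mult_le_one)
  have ggF: "\<bar>g x * g y * F u v\<bar> \<le> 1" for x y u v
  proof -
    have "0 \<le> g x * g y * F u v" using gg[of x y] F01[of u v] by simp
    moreover have "g x * g y * F u v \<le> 1" using mult_le_one[OF gg(2)[of x y] F01[of u v]] .
    ultimately show ?thesis by simp
  qed
  have [measurable]: "(\<lambda>y. F x y) \<in> borel_measurable borel" for x
    unfolding F_def[abs_def] by measurable
  have pointwise: "\<Phi> x \<le> (\<integral>y. g x * g (x + y) * F x y \<partial>circ_measure)" for x
  proof -
    have "\<delta> * (g x * g (x + y)) - (\<eta> + (D x y)\<^sup>2 / \<eta>) / 2 \<le> g x * g (x + y) * F x y" for y
    proof -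
      have "- \<bar>D x y\<bar> \<le> g x * g (x + y) * D x y"
      proof -
        have "\<bar>g x * g (x + y) * D x y\<bar> \<le> \<bar>D x y\<bar>"
          using gg[of x "x + y"] by (simp add: abs_mult mult_left_le_one_le)
        then show ?thesis by linarith
      qed
      moreover have "g x * g (x + y) * F x y = \<delta> * (g x * g (x + y)) + g x * g (x + y) * D x y"
        by (simp add: F_D algebra_simps)
      ultimately show ?thesis using abs_le_am_gm[OF \<eta>, of "D x y"] by linarith
    qed
    moreover have i1: "integrable circ_measure (\<lambda>y. g (x + y))" by (rule intC) (auto simp: g01)
    moreover have i2: "integrable circ_measure (\<lambda>y. (D x y)\<^sup>2)" by (rule intC) (auto simp: D2[simplified])
    moreover have "integrable circ_measure (\<lambda>y. g x * g (x + y) * F x y)"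
      by (rule intC) (use ggF in auto)
    ultimately have "(\<integral>y. \<delta> * (g x * g (x + y)) - (\<eta> + (D x y)\<^sup>2 / \<eta>) / 2 \<partial>circ_measure) \<le> (\<integral>y. g x * g (x + y) * F x y \<partial>circ_measure)"
      by (intro integral_mono) auto
    also have "(\<integral>y. \<delta> * (g x * g (x + y)) - (\<eta> + (D x y)\<^sup>2 / \<eta>) / 2 \<partial>circ_measure)
        = \<delta> * (g x * (\<delta> + E x)) - (\<eta> + Q x / \<eta>) / 2"
      using i1 i2 by (simp add: mean Q_def C.prob_space[simplified])
    finally have "\<delta> * (g x * (\<delta> + E x)) - (\<eta> + Q x / \<eta>) / 2 \<le> (\<integral>y. g x * g (x + y) * F x y \<partial>circ_measure)" .
    moreover have "\<delta> * (\<delta> * g x - (\<eta> + (E x)\<^sup>2 / \<eta>) / 2) \<le> \<delta> * (g x * (\<delta> + E x))"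
    proof (rule mult_left_mono)
      have "\<bar>g x * E x\<bar> \<le> \<bar>E x\<bar>"
        using g01[of x] by (simp add: abs_mult mult_left_le_one_le)
      moreover have "g x * (\<delta> + E x) = \<delta> * g x + g x * E x" by (simp add: algebra_simps)
      ultimately show "\<delta> * g x - (\<eta> + (E x)\<^sup>2 / \<eta>) / 2 \<le> g x * (\<delta> + E x)"
        using abs_le_am_gm[OF \<eta>, of "E x"] by linarith
    qed (use \<delta> in simp)
    ultimately show ?thesis unfolding \<Phi>_def by linarith
  qed
  have intB: "integrable lborel (\<lambda>x. indicator B x * f x)" if "f \<in> borel_measurable borel" "\<And>y. \<bar>f y\<bar> \<le> 1" for f :: "pt \<Rightarrow> real"
    using integrable_indicator_bounded[OF that(1) _ Bfin that(2)] by simp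
  have intI: "integrable lborel (indicator B :: pt \<Rightarrow> real)"
    using Bfin by (intro integrable_real_indicator) auto
  have iE: "integrable lborel (\<lambda>x. indicator B x * (E x)\<^sup>2)" by (rule intB) (use E2 in auto)
  have iQ: "integrable lborel (\<lambda>x. indicator B x * Q x)" by (rule intB) (use Q1 in auto)
  have ih: "integrable lborel (\<lambda>x. h x * indicator B x)" using intB[OF h habs] by (simp add: mult.commute)
  have \<Phi>_eq: "indicator B x * \<Phi> x = \<delta>\<^sup>2 * (\<delta> * indicator B x + h x * indicator B x) - \<delta> * \<eta> / 2 * indicator B x
      - \<delta> / (2 * \<eta>) * (indicator B x * (E x)\<^sup>2) - \<eta> / 2 * indicator B x - 1 / (2 * \<eta>) * (indicator B x * Q x)" for x
    unfolding \<Phi>_def g_h using \<eta> by (simp add: field_simps power2_eq_square)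
  have \<Phi>_int: "integrable lborel (\<lambda>x. indicator B x * \<Phi> x)"
    unfolding \<Phi>_eq using intI iE iQ ih by auto
  have "(\<integral>x. indicator B x * \<Phi> x \<partial>lborel) = \<delta>\<^sup>2 * (\<delta> * b + (\<integral>x. h x * indicator B x \<partial>lborel)) - \<delta> * \<eta> / 2 * b
      - \<delta> / (2 * \<eta>) * (\<integral>x. indicator B x * (E x)\<^sup>2 \<partial>lborel) - \<eta> / 2 * b - 1 / (2 * \<eta>) * (\<integral>x. indicator B x * Q x \<partial>lborel)"
    unfolding \<Phi>_eq using intI iE iQ ih by (simp add: b_def)
  moreover have b: "b > 0"
    unfolding b_def B_def by (simp add: content_ball_pos)
  moreover have "(\<integral>x. indicator B x * (E x)\<^sup>2 \<partial>lborel) < b * \<eta>\<^sup>2" using h1 by (simp add: E_def)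
  moreover have "(\<integral>x. indicator B x * Q x \<partial>lborel) < b * \<eta>\<^sup>2"
  proof -
    \<comment> \<open>Base point and direction are separate arguments, so that the shift 2 \<alpha>
      perp y acts on the base point only.\<close>
    define q where "q p = (\<integral>s. h (fst p + s *\<^sub>R snd p) \<partial>unit_segment)\<^sup>2" for p :: "pt \<times> pt"
    have "(\<integral>x. indicator B x * Q x \<partial>lborel) = (\<integral>x. indicator (ball 0 1) x * (\<integral>y. q (x + w y, y) \<partial>circ_measure) \<partial>lborel)"
      by (simp add: B_def Q_def D_def q_def)
    also have "\<dots> \<le> (\<integral>x. indicator (ball 0 (1 + 2 * M)) x * (\<integral>y. q (x, y) \<partial>circ_measure) \<partial>lborel)"
    proof (rule integral_translate_family_le[OF prob_space_circ_measure])
      show "q \<in> borel_measurable (borel \<Otimes>\<^sub>M circ_measure)" unfolding q_def[abs_def] by measurable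
      show "q p \<le> 1" for p
        unfolding q_def using U.abs_integral_le[OF habs] by (simp add: abs_square_le_1)
      show "AE y in circ_measure. norm (w y) \<le> 2 * M"
        using circ_measure_norm_1 by eventually_elim (use \<alpha> in \<open>simp add: w_def\<close>)
    qed (simp_all add: q_def)
    also have "\<dots> < b * \<eta>\<^sup>2" using h2 by (simp add: q_def)
    finally show ?thesis .
  qed
  ultimately have "(\<integral>x. indicator B x * \<Phi> x \<partial>lborel) > 0"
    using main_term_dominates[OF \<delta> b \<eta>_def[THEN meta_eq_to_obj_eq] h0] by simp
  also have "(\<integral>x. indicator B x * \<Phi> x \<partial>lborel) \<le> (\<integral>x. indicator B x * (\<integral>y. g x * g (x + y) * F x y \<partial>circ_measure) \<partial>lborel)"
  proof (rule integral_mono[OF \<Phi>_int])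
    show "integrable lborel (\<lambda>x. indicator B x * (\<integral>y. g x * g (x + y) * F x y \<partial>circ_measure))"
    proof (rule intB)
      show "(\<lambda>x. \<integral>y. g x * g (x + y) * F x y \<partial>circ_measure) \<in> borel_measurable borel"
        unfolding F_def by measurable
      show "\<bar>\<integral>y. g x * g (x + y) * F x y \<partial>circ_measure\<bar> \<le> 1" for x
        by (rule C.abs_integral_le) (rule ggF)
    qed
    show "indicator B x * \<Phi> x \<le> indicator B x * (\<integral>y. g x * g (x + y) * F x y \<partial>circ_measure)" for x
      using pointwise by (intro mult_left_mono) auto
  qed
  finally have "0 < (\<integral>x. indicator B x * (\<integral>y. g x * g (x + y) * F x y \<partial>circ_measure) \<partial>lborel)" .
  then have "0 < ennreal (exp (-1) * (\<integral>x. indicator B x * (\<integral>y. g x * g (x + y) * F x y \<partial>circ_measure) \<partial>lborel))"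
    by simp
  also have "\<dots> \<le> Tint \<alpha> g"
    unfolding F_def w_def by (rule Tint_lower_bound) (auto simp: g01)
  finally show ?thesis by simp
qed

section \<open>Weak-* neighbourhoods and mildness\<close>

lemma S2_open_basic:
  fixes c :: "(pt \<Rightarrow> real) \<Rightarrow> real"
  assumes H: "finite H" "\<And>k. k \<in> H \<Longrightarrow> integrable lborel k"
  shows "S2_open {g \<in> S2. \<forall>k\<in>H. \<bar>(\<integral>x. g x * k x \<partial>lborel) - c k\<bar> < e}" (is "S2_open ?U")
  unfolding S2_open_def
proof (intro conjI ballI)
  fix f assume f: "f \<in> ?U"
  let ?r = "\<lambda>k. e - \<bar>(\<integral>x. f x * k x \<partial>lborel) - c k\<bar>"
  let ?e = "Min (insert 1 (?r ` H))"
  have "?e > 0" using f H(1) by (subst Min_gr_iff) auto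
  moreover have "?e \<le> ?r k" if "k \<in> H" for k using that H(1) by (intro Min_le) auto
  then have "{g \<in> S2. \<forall>k\<in>H. \<bar>(\<integral>x. g x * k x \<partial>lborel) - (\<integral>x. f x * k x \<partial>lborel)\<bar> < ?e} \<subseteq> ?U"
    by (force simp: abs_less_iff)
  ultimately show "\<exists>H. \<exists>\<epsilon>>0. finite H \<and> (\<forall>h\<in>H. integrable lborel h) \<and>
      {g \<in> S2. \<forall>h\<in>H. \<bar>(\<integral>x. g x * h x \<partial>lborel) - (\<integral>x. f x * h x \<partial>lborel)\<bar> < \<epsilon>} \<subseteq> ?U"
    using H by (intro exI[of _ H] exI[of _ ?e]) auto
qed auto

text \<open>Integrals against test functions do not see null sets. This lets a neighbourhood in
  terms of functions answer a question about classes: any Borel representative of an indicator may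
  be used.\<close>

lemma S2_open_AE_cong:
  assumes "S2_open U" "f \<in> U" "g \<in> S2" "AE x in lborel. f x = g x"
  shows "g \<in> U"
proof -
  obtain H \<epsilon> where H: "\<epsilon> > 0" "finite H" "\<forall>h\<in>H. integrable lborel h"
    "{g \<in> S2. \<forall>h\<in>H. \<bar>(\<integral>x. g x * h x \<partial>lborel) - (\<integral>x. f x * h x \<partial>lborel)\<bar> < \<epsilon>} \<subseteq> U"
    using assms(1,2) unfolding S2_open_def by meson
  have f: "f \<in> S2" using assms(1,2) by (auto simp: S2_open_def)
  have "(\<integral>x. g x * h x \<partial>lborel) = (\<integral>x. f x * h x \<partial>lborel)" if "h \<in> H" for h
  proof (rule integral_cong_AE)
    have [measurable]: "h \<in> borel_measurable lborel" "f \<in> borel_measurable lborel" "g \<in> borel_measurable lborel"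
      using H(3) that f assms(3) by (auto simp: S2_def)
    show "(\<lambda>x. g x * h x) \<in> borel_measurable lborel" "(\<lambda>x. f x * h x) \<in> borel_measurable lborel" by measurable
    show "AE x in lborel. g x * h x = f x * h x" using assms(4) by eventually_elim simp
  qed
  then show ?thesis using H(1,4) assms(3) by auto
qed

text \<open>Exceptional values are sent to 0 rather than to the nearest endpoint, so that the
  integrand of \<^const>\<open>Tint\<close> can only decrease and no null sets enter there.\<close>

definition clamp01 :: "(pt \<Rightarrow> real) \<Rightarrow> pt \<Rightarrow> real" where
  "clamp01 g x = (if 0 \<le> g x \<and> g x \<le> 1 then g x else 0)"

lemma clamp01_bounds: "0 \<le> clamp01 g x" "clamp01 g x \<le> 1"
  by (auto simp: clamp01_def)

lemma Tint_clamp01_le: "Tint \<alpha> (clamp01 g) \<le> Tint \<alpha> g"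
proof -
  have "ennreal (c * clamp01 g x * clamp01 g y * clamp01 g z) \<le> ennreal (c * g x * g y * g z)"
    for c x y z by (auto simp: clamp01_def)
  then show ?thesis unfolding Tint_def by (intro nn_integral_mono mult_right_mono) auto
qed

text \<open>Clamping changes g on a null set, so all tests against \<open>H\<close> keep their
  values, while the difference of two numbers in [0,1] now meets the pointwise bound built into the
  filter.\<close>

lemma S2_neighbourhood:
  fixes \<delta> :: real
  assumes \<delta>: "0 < \<delta>" "\<delta> \<le> 1" and P: "eventually P weak_star_null"
  obtains U where "S2_open U" "(\<lambda>_. \<delta>) \<in> U" "\<And>g. g \<in> U \<Longrightarrow> P (\<lambda>x. clamp01 g x - \<delta>)"
proof -
  obtain H e where H: "finite H" "\<And>k. k \<in> H \<Longrightarrow> integrable lborel k" "e > 0"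
    "\<And>h. h \<in> borel_measurable borel \<Longrightarrow> (\<And>x. \<bar>h x\<bar> \<le> 1) \<Longrightarrow>
       (\<And>k. k \<in> H \<Longrightarrow> \<bar>\<integral>x. h x * k x \<partial>lborel\<bar> < e) \<Longrightarrow> P h"
    using eventually_weak_star_nullE[OF P] by metis
  let ?U = "{g \<in> S2. \<forall>k\<in>H. \<bar>(\<integral>x. g x * k x \<partial>lborel) - (\<integral>x. \<delta> * k x \<partial>lborel)\<bar> < e}"
  show ?thesis
  proof (rule that[of ?U])
    show "S2_open ?U" by (rule S2_open_basic[OF H(1,2)])
    show "(\<lambda>_. \<delta>) \<in> ?U" using \<delta> H(3) by (auto simp: S2_def)
    fix g assume g: "g \<in> ?U"
    then have [measurable]: "g \<in> borel_measurable borel" and ae: "AE x in lborel. 0 \<le> g x \<and> g x \<le> 1"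
      by (auto simp: S2_def)
    have [measurable]: "clamp01 g \<in> borel_measurable borel" unfolding clamp01_def[abs_def] by measurable
    show "P (\<lambda>x. clamp01 g x - \<delta>)"
    proof (rule H(4))
      show "\<bar>clamp01 g x - \<delta>\<bar> \<le> 1" for x
        using clamp01_bounds[of g x] \<delta> by (auto simp: abs_le_iff)
      fix k assume k: "k \<in> H"
      note ik = H(2)[OF k]
      have [measurable]: "k \<in> borel_measurable borel" using ik by auto
      have ick: "integrable lborel (\<lambda>x. clamp01 g x * k x)"
      proof (rule Bochner_Integration.integrable_bound[OF ik])
        have "norm (clamp01 g x * k x) \<le> norm (k x)" for x
          using clamp01_bounds[of g x] by (simp add: abs_mult mult_left_le_one_le)
        then show "AE x in lborel. norm (clamp01 g x * k x) \<le> norm (k x)" by simp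
      qed simp
      have "(\<integral>x. (clamp01 g x - \<delta>) * k x \<partial>lborel) = (\<integral>x. clamp01 g x * k x \<partial>lborel) - (\<integral>x. \<delta> * k x \<partial>lborel)"
        using ick ik by (simp add: left_diff_distrib)
      also have "(\<integral>x. clamp01 g x * k x \<partial>lborel) = (\<integral>x. g x * k x \<partial>lborel)"
      proof (rule integral_cong_AE)
        show "AE x in lborel. clamp01 g x * k x = g x * k x"
          using ae by eventually_elim (simp add: clamp01_def)
      qed measurable
      finally show "\<bar>\<integral>x. (clamp01 g x - \<delta>) * k x \<partial>lborel\<bar> < e" using g k by auto
    qed measurable
  qed
qed

text \<open>The neighbourhood is chosen from M and \<delta> before \<alpha> is introduced.
  Nonvanishing passes from the clamped function to g because clamping never increases the
  integral.\<close>

lemma Tint_nonzero_neighbourhood: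
  fixes \<delta> M :: real
  assumes \<delta>: "0 < \<delta>" "\<delta> \<le> 1"
  shows "\<exists>U. S2_open U \<and> (\<lambda>_. \<delta>) \<in> U \<and> U \<subseteq> {g\<in>S2. \<forall>\<alpha>\<in>{0<..M}. Tint \<alpha> g \<noteq> 0}"
proof -
  define b where "b = measure lborel (ball (0::pt) 1)"
  have b: "b > 0" unfolding b_def by (simp add: content_ball_pos)
  have fin: "emeasure lborel (ball (0::pt) r) < \<infinity>" for r
    by (simp add: emeasure_lborel_ball_finite[simplified])
  have pos: "b * (\<delta> ^ 3 / 4)\<^sup>2 > 0" "b * \<delta> / 4 > 0" using b \<delta> by auto
  have "integrable lborel (indicator (ball (0::pt) 1) :: pt \<Rightarrow> real)"
    using fin by (intro integrable_real_indicator) auto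
  note t0 = tendstoD[OF tendsto_weak_star_null[OF this] pos(2)]
  note t1 = order_tendstoD(2)[OF circular_average_tendsto[OF _ fin[of 1]] pos(1)]
  note t2 = order_tendstoD(2)[OF segment_average_tendsto[OF _ fin[of "1 + 2 * M"]] pos(1)]
  have "eventually (\<lambda>h. \<bar>\<integral>x. h x * indicator (ball 0 1) x \<partial>lborel\<bar> < b * \<delta> / 4 \<and>
      (\<integral>x. indicator (ball 0 1) x * (\<integral>y. h (x + y) \<partial>circ_measure)\<^sup>2 \<partial>lborel) < b * (\<delta> ^ 3 / 4)\<^sup>2 \<and>
      (\<integral>x. indicator (ball 0 (1 + 2 * M)) x *
        (\<integral>y. (\<integral>s. h (x + s *\<^sub>R y) \<partial>unit_segment)\<^sup>2 \<partial>circ_measure) \<partial>lborel) < b * (\<delta> ^ 3 / 4)\<^sup>2) weak_star_null"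
    using t0 t1 t2 by (simp add: dist_real_def eventually_conj_iff)
  then obtain U where U: "S2_open U" "(\<lambda>_. \<delta>) \<in> U" and close: "\<And>g. g \<in> U \<Longrightarrow>
      \<bar>\<integral>x. (clamp01 g x - \<delta>) * indicator (ball 0 1) x \<partial>lborel\<bar> < b * \<delta> / 4 \<and>
      (\<integral>x. indicator (ball 0 1) x * (\<integral>y. clamp01 g (x + y) - \<delta> \<partial>circ_measure)\<^sup>2 \<partial>lborel) < b * (\<delta> ^ 3 / 4)\<^sup>2 \<and>
      (\<integral>x. indicator (ball 0 (1 + 2 * M)) x *
        (\<integral>y. (\<integral>s. clamp01 g (x + s *\<^sub>R y) - \<delta> \<partial>unit_segment)\<^sup>2 \<partial>circ_measure) \<partial>lborel) < b * (\<delta> ^ 3 / 4)\<^sup>2"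
    by (rule S2_neighbourhood[OF \<delta>]) blast
  have "Tint \<alpha> g \<noteq> 0" if g: "g \<in> U" and \<alpha>: "0 < \<alpha>" "\<alpha> \<le> M" for g \<alpha>
  proof -
    have [measurable]: "g \<in> borel_measurable borel" using U(1) g by (auto simp: S2_open_def S2_def)
    have "clamp01 g \<in> borel_measurable borel" unfolding clamp01_def[abs_def] by measurable
    then have "Tint \<alpha> (clamp01 g) \<noteq> 0"
      using close[OF g] \<delta> \<alpha> clamp01_bounds unfolding b_def by (intro Tint_nonzero) auto
    then show ?thesis using Tint_clamp01_le[of \<alpha> g] by auto
  qed
  then show ?thesis using U by (intro exI[of _ U]) (auto simp: S2_open_def)
qed

section \<open>Triangles from a nonvanishing integral\<close>

lemma tri_area_perp: "norm y = 1 \<Longrightarrow> tri_area x (x + y) (x + (2 * \<alpha>) *\<^sub>R perp y + s *\<^sub>R y) = \<bar>\<alpha>\<bar>"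
proof -
  assume "norm y = 1"
  then have y: "(y$1)\<^sup>2 + (y$2)\<^sup>2 = 1" by (simp add: norm_vec_def L2_set_def sum_2)
  \<comment> \<open>Base y of length 1 and height 2 |\<alpha>|: the parameter s slides the apex
    parallel to the base and cancels.\<close>
  have "y$1 * (2 * \<alpha> * y$1 + s * y$2) - y$2 * (- (2 * \<alpha> * y$2) + s * y$1) = 2 * \<alpha> * ((y$1)\<^sup>2 + (y$2)\<^sup>2)"
    by (simp add: algebra_simps power2_eq_square)
  then show ?thesis unfolding y by (simp add: tri_area_def perp_def abs_mult)
qed

text \<open>Without such a triangle the integrand vanishes whenever y has norm 1.
  \<open>circ_measure\<close> is a measure on the whole plane, so this gives vanishing only almost
  everywhere in y, which is enough for the integral.\<close>

lemma Tint_indicator_nonzeroE: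
  assumes "Tint \<alpha> (indicator A) \<noteq> 0"
  obtains x y z where "x \<in> A" "y \<in> A" "z \<in> A" "tri_area x y z = \<bar>\<alpha>\<bar>" "dist x y = 1"
proof (rule ccontr)
  assume no: "\<not> thesis"
  note found = that
  have "indicator A x * indicator A (x + y) * indicator A (x + (2 * \<alpha>) *\<^sub>R perp y + s *\<^sub>R y) = (0::real)"
    if "norm y = 1" for x y s
  proof (rule ccontr)
    assume "\<not> ?thesis"
    then have "x \<in> A" "x + y \<in> A" "x + (2 * \<alpha>) *\<^sub>R perp y + s *\<^sub>R y \<in> A"
      by (auto simp: indicator_def split: if_splits)
    moreover have "dist x (x + y) = 1" using that by (simp add: dist_norm)
    ultimately show False using no found tri_area_perp[OF \<open>norm y = 1\<close>] by blast
  qed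
  then have "exp (- s) * indicator A x * indicator A (x + y) *
      indicator A (x + (2 * \<alpha>) *\<^sub>R perp y + s *\<^sub>R y) = (0::real)" if "norm y = 1" for x y s
    using that by (simp only: mult.assoc mult_zero_right)
  then have inner: "(\<integral>\<^sup>+ s\<in>{0..}. ennreal (exp (- s) * indicator A x * indicator A (x + y) *
      indicator A (x + (2 * \<alpha>) *\<^sub>R perp y + s *\<^sub>R y)) \<partial>lborel) = 0" if "norm y = 1" for x y
    using that by (simp only: ennreal_0 mult_zero_left nn_integral_const)
  have "(\<integral>\<^sup>+ y. (\<integral>\<^sup>+ s\<in>{0..}. ennreal (exp (- s) * indicator A x * indicator A (x + y) *
      indicator A (x + (2 * \<alpha>) *\<^sub>R perp y + s *\<^sub>R y)) \<partial>lborel) \<partial>circ_measure) = (\<integral>\<^sup>+ y. 0 \<partial>circ_measure)" for x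
    by (rule nn_integral_cong_AE, rule eventually_mono[OF circ_measure_norm_1]) (rule inner)
  then have "Tint \<alpha> (indicator A) = 0" unfolding Tint_def by simp
  with assms show False by simp
qed

lemma P_M_translate:
  assumes "P_M M A" shows "P_M M ((\<lambda>x. x + v) ` A)"
  unfolding P_M_def
proof
  fix \<alpha> assume "\<alpha> \<in> {0<..M}"
  then obtain x y z where *: "x \<in> A" "y \<in> A" "z \<in> A" "tri_area x y z = \<alpha>"
      "dist x y = 1 \<or> dist y z = 1 \<or> dist x z = 1"
    using assms unfolding P_M_def by meson
  then have "tri_area (x + v) (y + v) (z + v) = \<alpha>"
    "dist (x + v) (y + v) = 1 \<or> dist (y + v) (z + v) = 1 \<or> dist (x + v) (z + v) = 1"
    by (simp_all add: tri_area_def)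
  with * show "\<exists>x\<in>(\<lambda>x. x + v) ` A. \<exists>y\<in>(\<lambda>x. x + v) ` A. \<exists>z\<in>(\<lambda>x. x + v) ` A. tri_area x y z = \<alpha> \<and>
      (dist x y = 1 \<or> dist y z = 1 \<or> dist x z = 1)" by blast
qed

text \<open>A Lebesgue set contains a Borel set \<open>A'\<close> that differs from it by a null
  set. The indicator of \<open>A'\<close> stays in U, and a triangle found in \<open>A'\<close> is
  one in A.\<close>

lemma P_M_if_Tint_nonzero:
  assumes U: "S2_open U" "U \<subseteq> {g\<in>S2. \<forall>\<alpha>\<in>{0<..M}. Tint \<alpha> g \<noteq> 0}"
    and A: "A \<in> sets lebesgue" and f: "f \<in> U" "AE x in lebesgue. f x = indicator A x"
  shows "P_M M A"
proof -
  obtain A' N N' where A': "A = A' \<union> N" "A' \<in> sets lborel" "N \<subseteq> N'" "N' \<in> null_sets lborel"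
    using A by (auto elim: sets_completionE)
  have "AE x in lborel. x \<notin> N'" using A'(4) by (rule AE_not_in)
  moreover have "AE x in lborel. f x = indicator A x" using f(2) by (simp add: AE_completion_iff)
  ultimately have "AE x in lborel. f x = indicator A' x"
    by eventually_elim (use A' in \<open>auto simp: indicator_def\<close>)
  moreover have "indicator A' \<in> S2" using A'(2) by (auto simp: S2_def indicator_def)
  ultimately have "indicator A' \<in> U" by (intro S2_open_AE_cong[OF U(1) f(1)])
  then have nz: "Tint \<alpha> (indicator A') \<noteq> 0" if "\<alpha> \<in> {0<..M}" for \<alpha> using U(2) that by auto
  show ?thesis
    unfolding P_M_def
  proof
    fix \<alpha> assume \<alpha>: "\<alpha> \<in> {0<..M}"
    obtain x y z where "x \<in> A'" "y \<in> A'" "z \<in> A'" "tri_area x y z = \<bar>\<alpha>\<bar>" "dist x y = 1"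
      by (rule Tint_indicator_nonzeroE[OF nz[OF \<alpha>]])
    then show "\<exists>x\<in>A. \<exists>y\<in>A. \<exists>z\<in>A. tri_area x y z = \<alpha> \<and> (dist x y = 1 \<or> dist y z = 1 \<or> dist x z = 1)"
      using A'(1) \<alpha> by (intro bexI[of _ x] bexI[of _ y] bexI[of _ z]) auto
  qed
qed

theorem theorem1p7:
  fixes M :: real
  assumes "M > 0"
  shows "(\<forall>\<delta>\<in>{0<..1}. \<exists>U. S2_open U \<and> (\<lambda>_. \<delta>) \<in> U \<and>
            U \<subseteq> {g\<in>S2. \<forall>\<alpha>\<in>{0<..M}. Tint \<alpha> g \<noteq> 0})
         \<and> mild (P_M M)"
proof
  show nbhd: "\<forall>\<delta>\<in>{0<..1}. \<exists>U. S2_open U \<and> (\<lambda>_. \<delta>) \<in> U \<and> U \<subseteq> {g\<in>S2. \<forall>\<alpha>\<in>{0<..M}. Tint \<alpha> g \<noteq> 0}"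
    using Tint_nonzero_neighbourhood by auto
  have "P_M M A = P_M M ((\<lambda>x. x + v) ` A)" for A v
    using P_M_translate[of M A v] P_M_translate[of M "(\<lambda>x. x + v) ` A" "- v"]
    by (auto simp: image_image)
  then show "mild (P_M M)"
    unfolding mild_def delta_mild_def using nbhd P_M_if_Tint_nonzero by meson
qed

end
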